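(* Let $\mathsf{A}$ be an abelian category, $\mathsf{V}$ a special preenveloping subcategory of $\mathsf{A}$ and $\mathsf{W}$ a special precovering subcategory of $\mathsf{A}$. Let $\mathrm{F}$ (resp. $\mathrm{G}$) be a contravariant (resp. covariant) additive functor from $\mathsf{A}$ to the category $\mathsf{Ab}$ of abelian groups. If $\mathrm{F}$ is half $\operatorname{Hom}_{\mathsf{A}}(-,\mathsf{V})$-exact, then so is the $\mathsf{V}$-stable functor $\overline{\mathrm{F}}^{\mathsf{V}}$. If $\mathrm{G}$ is half $\operatorname{Hom}_{\mathsf{A}}(\mathsf{W},-)$-exact, then so is the $\mathsf{W}$-stable functor $\underline{\mathrm{G}}^{\mathsf{W}}$.
   Context: "Subcategory" means a full additive subcategory closed under isomorphisms; Ext is Yoneda Ext. ${}^{\perp}\mathsf{V}=\{M\mid\operatorname{Ext}^1_{\mathsf{A}}(M,V)=0\ \forall V\in\mathsf{V}\}$, $\mathsf{W}^{\perp}=\{N\mid\operatorname{Ext}^1_{\mathsf{A}}(W,N)=0\ \forall W\in\mathsf{W}\}$. $\mathsf{V}$ is special preenveloping if every object $M$ admits an exact sequence $0\to M\to V\to C\to0$ with $V\in\mathsf{V}$, $C\in{}^{\perp}\mathsf{V}$; $\mathsf{W}$ is special precovering if every $M$ admits an exact sequence $0\to K\to W\to M\to0$ with $W\in\mathsf{W}$, $K\in\mathsf{W}^{\perp}$. A sequence is $\operatorname{Hom}_{\mathsf{A}}(-,\mathsf{V})$-exact (resp. $\operatorname{Hom}_{\mathsf{A}}(\mathsf{W},-)$-exact)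 if it stays exact under $\operatorname{Hom}_{\mathsf{A}}(-,V)$ for all $V\in\mathsf{V}$ (resp. $\operatorname{Hom}_{\mathsf{A}}(W,-)$ for all $W\in\mathsf{W}$). A proper $\mathsf{V}$-coresolution of $M$ is given by a $\operatorname{Hom}_{\mathsf{A}}(-,\mathsf{V})$-exact exact sequence $0\to M\xrightarrow{d}I^0\to I^1\to\cdots$ with $I^j\in\mathsf{V}$; a proper $\mathsf{W}$-resolution of $N$ is given by a $\operatorname{Hom}_{\mathsf{A}}(\mathsf{W},-)$-exact exact sequence $\cdots\to P_1\to P_0\xrightarrow{f}N\to0$ with $P_j\in\mathsf{W}$. $\overline{\mathrm{F}}^{\mathsf{V}}$ is the cokernel of the natural transformation $\rho\colon\mathrm{L}_0^{\mathsf{V}}\mathrm{F}\to\mathrm{F}$ induced by $\mathrm{F}(d)$, where $\mathrm{L}_0^{\mathsf{V}}\mathrm{F}(M)=\operatorname{Coker}(\mathrm{F}(I^1)\to\mathrm{F}(I^0))$. $\underline{\mathrm{G}}^{\mathsf{W}}$ is the cokernel of $\varrho\colon\mathrm{L}_0^{\mathsf{W}}\mathrm{G}\to\mathrm{G}$ induced by $\mathrm{G}(f)$, where $\mathrm{L}_0^{\mathsf{W}}\mathrm{G}(N)=\operatorname{Coker}(\mathrm{G}(P_1)\to\mathrm{G}(P_0))$. Both are independent of choices. $\mathrm{F}$ is half $\operatorname{Hom}_{\mathsf{A}}(-,\mathsf{V})$-exact if for each $\operatorname{Hom}_{\mathsf{A}}(-,\mathsf{V})$-exact short exact sequence $0\to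 A'\to A\to A''\to0$ the sequence $\mathrm{F}(A'')\to\mathrm{F}(A)\to\mathrm{F}(A')$ is exact. $\mathrm{G}$ is half $\operatorname{Hom}_{\mathsf{A}}(\mathsf{W},-)$-exact if for each $\operatorname{Hom}_{\mathsf{A}}(\mathsf{W},-)$-exact short exact sequence $0\to A'\to A\to A''\to0$ the sequence $\mathrm{G}(A')\to\mathrm{G}(A)\to\mathrm{G}(A'')$ is exact. *)

theory Defs
  imports "HOL-Algebra.Exact_Sequence"
begin

section \<open>Abelian categories\<close>

text \<open>
  A category with objects in \<^typ>\<open>'o\<close> and morphisms in \<^typ>\<open>'m\<close>, together with the data
  of an enrichment in abelian groups: \<open>Add\<close> is the addition of parallel morphisms and
  \<open>Zero A X Y\<close> is the zero morphism from \<open>X\<close> to \<open>Y\<close>. Composition is written in the usual order: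
  \<open>g \<cdot> f\<close> means \<open>f\<close> first.
\<close>

record ('o, 'm) cat =
  Obj :: "'o set"
  Mor :: "'m set"
  Dom :: "'m \<Rightarrow> 'o"
  Cod :: "'m \<Rightarrow> 'o"
  Id :: "'o \<Rightarrow> 'm"
  Comp :: "'m \<Rightarrow> 'm \<Rightarrow> 'm"  (infixl "\<cdot>\<index>" 70)
  Add :: "'m \<Rightarrow> 'm \<Rightarrow> 'm"  (infixl "\<boxplus>\<index>" 65)
  Zero :: "'o \<Rightarrow> 'o \<Rightarrow> 'm"

definition Hom :: "('o, 'm) cat \<Rightarrow> 'o \<Rightarrow> 'o \<Rightarrow> 'm set" where
  "Hom A X Y = {f \<in> Mor A. Dom A f = X \<and> Cod A f = Y}"

definition hom_group :: "('o, 'm) cat \<Rightarrow> 'o \<Rightarrow> 'o \<Rightarrow> 'm monoid" where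
  "hom_group A X Y = \<lparr>carrier = Hom A X Y, monoid.mult = Add A, one = Zero A X Y\<rparr>"

locale category =
  fixes A :: "('o, 'm) cat" (structure)
  assumes Dom_Obj [simp]: "f \<in> Mor A \<Longrightarrow> Dom A f \<in> Obj A"
    and Cod_Obj [simp]: "f \<in> Mor A \<Longrightarrow> Cod A f \<in> Obj A"
    and Id_Hom: "X \<in> Obj A \<Longrightarrow> Id A X \<in> Hom A X X"
    and comp_Hom: "\<lbrakk>f \<in> Hom A X Y; g \<in> Hom A Y Z\<rbrakk> \<Longrightarrow> g \<cdot> f \<in> Hom A X Z"
    and comp_assoc: "\<lbrakk>f \<in> Hom A W X; g \<in> Hom A X Y; h \<in> Hom A Y Z\<rbrakk> \<Longrightarrow> h \<cdot> g \<cdot> f = h \<cdot> (g \<cdot> f)"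
    and comp_Id_left: "f \<in> Hom A X Y \<Longrightarrow> Id A Y \<cdot> f = f"
    and comp_Id_right: "f \<in> Hom A X Y \<Longrightarrow> f \<cdot> Id A X = f"

locale preadditive_category = category +
  assumes comm_group_hom_group: "\<lbrakk>X \<in> Obj A; Y \<in> Obj A\<rbrakk> \<Longrightarrow> comm_group (hom_group A X Y)"
    and comp_add_left:
      "\<lbrakk>f \<in> Hom A X Y; g \<in> Hom A Y Z; h \<in> Hom A Y Z\<rbrakk> \<Longrightarrow> (g \<boxplus> h) \<cdot> f = g \<cdot> f \<boxplus> h \<cdot> f"
    and comp_add_right:
      "\<lbrakk>f \<in> Hom A X Y; g \<in> Hom A X Y; h \<in> Hom A Y Z\<rbrakk> \<Longrightarrow> h \<cdot> (f \<boxplus> g) = h \<cdot> f \<boxplus> h \<cdot> g"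

definition is_zero_object :: "('o, 'm) cat \<Rightarrow> 'o \<Rightarrow> bool" where
  "is_zero_object A Z \<longleftrightarrow>
    Z \<in> Obj A \<and> (\<forall>X\<in>Obj A. (\<exists>!f. f \<in> Hom A Z X) \<and> (\<exists>!f. f \<in> Hom A X Z))"

definition zero_object :: "('o, 'm) cat \<Rightarrow> 'o" where
  "zero_object A = (SOME Z. is_zero_object A Z)"

definition is_biproduct ::
  "('o, 'm) cat \<Rightarrow> 'o \<Rightarrow> 'o \<Rightarrow> 'o \<Rightarrow> 'm \<Rightarrow> 'm \<Rightarrow> 'm \<Rightarrow> 'm \<Rightarrow> bool" where
  "is_biproduct A X Y S i1 i2 p1 p2 \<longleftrightarrow>
    i1 \<in> Hom A X S \<and> i2 \<in> Hom A Y S \<and> p1 \<in> Hom A S X \<and> p2 \<in> Hom A S Y \<and>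
    p1 \<cdot>\<^bsub>A\<^esub> i1 = Id A X \<and> p2 \<cdot>\<^bsub>A\<^esub> i2 = Id A Y \<and>
    p1 \<cdot>\<^bsub>A\<^esub> i2 = Zero A Y X \<and> p2 \<cdot>\<^bsub>A\<^esub> i1 = Zero A X Y \<and>
    i1 \<cdot>\<^bsub>A\<^esub> p1 \<boxplus>\<^bsub>A\<^esub> i2 \<cdot>\<^bsub>A\<^esub> p2 = Id A S"

definition is_kernel :: "('o, 'm) cat \<Rightarrow> 'm \<Rightarrow> 'm \<Rightarrow> bool" where
  "is_kernel A k f \<longleftrightarrow>
    k \<in> Mor A \<and> f \<in> Mor A \<and> Cod A k = Dom A f \<and> f \<cdot>\<^bsub>A\<^esub> k = Zero A (Dom A k) (Cod A f) \<and>
    (\<forall>h\<in>Mor A. Cod A h = Dom A f \<and> f \<cdot>\<^bsub>A\<^esub> h = Zero A (Dom A h) (Cod A f) \<longrightarrow>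
      (\<exists>!u. u \<in> Hom A (Dom A h) (Dom A k) \<and> k \<cdot>\<^bsub>A\<^esub> u = h))"

definition is_cokernel :: "('o, 'm) cat \<Rightarrow> 'm \<Rightarrow> 'm \<Rightarrow> bool" where
  "is_cokernel A c f \<longleftrightarrow>
    c \<in> Mor A \<and> f \<in> Mor A \<and> Dom A c = Cod A f \<and> c \<cdot>\<^bsub>A\<^esub> f = Zero A (Dom A f) (Cod A c) \<and>
    (\<forall>h\<in>Mor A. Dom A h = Cod A f \<and> h \<cdot>\<^bsub>A\<^esub> f = Zero A (Dom A f) (Cod A h) \<longrightarrow>
      (\<exists>!u. u \<in> Hom A (Cod A c) (Cod A h) \<and> u \<cdot>\<^bsub>A\<^esub> c = h))"

definition monic :: "('o, 'm) cat \<Rightarrow> 'm \<Rightarrow> bool" where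
  "monic A m \<longleftrightarrow> m \<in> Mor A \<and>
    (\<forall>X. \<forall>g\<in>Hom A X (Dom A m). \<forall>h\<in>Hom A X (Dom A m). m \<cdot>\<^bsub>A\<^esub> g = m \<cdot>\<^bsub>A\<^esub> h \<longrightarrow> g = h)"

definition epic :: "('o, 'm) cat \<Rightarrow> 'm \<Rightarrow> bool" where
  "epic A e \<longleftrightarrow> e \<in> Mor A \<and>
    (\<forall>X. \<forall>g\<in>Hom A (Cod A e) X. \<forall>h\<in>Hom A (Cod A e) X. g \<cdot>\<^bsub>A\<^esub> e = h \<cdot>\<^bsub>A\<^esub> e \<longrightarrow> g = h)"

definition isomorphism :: "('o, 'm) cat \<Rightarrow> 'm \<Rightarrow> bool" where
  "isomorphism A f \<longleftrightarrow> f \<in> Mor A \<and>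
    (\<exists>g\<in>Hom A (Cod A f) (Dom A f). g \<cdot>\<^bsub>A\<^esub> f = Id A (Dom A f) \<and> f \<cdot>\<^bsub>A\<^esub> g = Id A (Cod A f))"

locale abelian_category = preadditive_category +
  assumes zero_object_exists: "\<exists>Z. is_zero_object A Z"
    and biproduct_exists:
      "\<lbrakk>X \<in> Obj A; Y \<in> Obj A\<rbrakk> \<Longrightarrow> \<exists>S i1 i2 p1 p2. is_biproduct A X Y S i1 i2 p1 p2"
    and kernel_exists: "f \<in> Mor A \<Longrightarrow> \<exists>k. is_kernel A k f"
    and cokernel_exists: "f \<in> Mor A \<Longrightarrow> \<exists>c. is_cokernel A c f"
    and monic_normal: "monic A m \<Longrightarrow> \<exists>f. is_kernel A m f"
    and epic_normal: "epic A e \<Longrightarrow> \<exists>f. is_cokernel A e f"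


section \<open>Exact sequences\<close>

text \<open>The image of a morphism is the kernel of its cokernel.\<close>

definition is_image :: "('o, 'm) cat \<Rightarrow> 'm \<Rightarrow> 'm \<Rightarrow> bool" where
  "is_image A m f \<longleftrightarrow> (\<exists>c. is_cokernel A c f \<and> is_kernel A m c)"

text \<open>Exactness of \<open>\<bullet> \<rightarrow> \<bullet> \<rightarrow> \<bullet>\<close>, first map \<open>f\<close>, second map \<open>g\<close>, at the middle object.\<close>

definition exact_at :: "('o, 'm) cat \<Rightarrow> 'm \<Rightarrow> 'm \<Rightarrow> bool" where
  "exact_at A f g \<longleftrightarrow> (\<exists>m. is_image A m f \<and> is_kernel A m g)"

text \<open>The four maps of \<open>0 \<rightarrow> A' \<rightarrow> A \<rightarrow> A'' \<rightarrow> 0\<close>.\<close>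

definition ses :: "('o, 'm) cat \<Rightarrow> 'm \<Rightarrow> 'm \<Rightarrow> 'm list" where
  "ses A i p = [Zero A (zero_object A) (Dom A i), i, p, Zero A (Cod A p) (zero_object A)]"

definition short_exact :: "('o, 'm) cat \<Rightarrow> 'm \<Rightarrow> 'm \<Rightarrow> bool" where
  "short_exact A i p \<longleftrightarrow> successively (exact_at A) (ses A i p)"


section \<open>Functors to abelian groups\<close>

record ('o, 'm, 'g) functor_to_Ab =
  FObj :: "'o \<Rightarrow> 'g monoid"
  FMor :: "'m \<Rightarrow> 'g \<Rightarrow> 'g"

definition contravariant_additive_functor ::
  "('o, 'm) cat \<Rightarrow> ('o, 'm, 'g) functor_to_Ab \<Rightarrow> bool" where
  "contravariant_additive_functor A F \<longleftrightarrow>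
    (\<forall>X\<in>Obj A. comm_group (FObj F X)) \<and>
    (\<forall>X Y. \<forall>f\<in>Hom A X Y. FMor F f \<in> hom (FObj F Y) (FObj F X)) \<and>
    (\<forall>X\<in>Obj A. \<forall>x\<in>carrier (FObj F X). FMor F (Id A X) x = x) \<and>
    (\<forall>X Y Z. \<forall>f\<in>Hom A X Y. \<forall>g\<in>Hom A Y Z. \<forall>x\<in>carrier (FObj F Z).
      FMor F (g \<cdot>\<^bsub>A\<^esub> f) x = FMor F f (FMor F g x)) \<and>
    (\<forall>X Y. \<forall>f\<in>Hom A X Y. \<forall>g\<in>Hom A X Y. \<forall>x\<in>carrier (FObj F Y).
      FMor F (f \<boxplus>\<^bsub>A\<^esub> g) x = FMor F f x \<otimes>\<^bsub>FObj F X\<^esub> FMor F g x)"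

definition covariant_additive_functor ::
  "('o, 'm) cat \<Rightarrow> ('o, 'm, 'g) functor_to_Ab \<Rightarrow> bool" where
  "covariant_additive_functor A G \<longleftrightarrow>
    (\<forall>X\<in>Obj A. comm_group (FObj G X)) \<and>
    (\<forall>X Y. \<forall>f\<in>Hom A X Y. FMor G f \<in> hom (FObj G X) (FObj G Y)) \<and>
    (\<forall>X\<in>Obj A. \<forall>x\<in>carrier (FObj G X). FMor G (Id A X) x = x) \<and>
    (\<forall>X Y Z. \<forall>f\<in>Hom A X Y. \<forall>g\<in>Hom A Y Z. \<forall>x\<in>carrier (FObj G X).
      FMor G (g \<cdot>\<^bsub>A\<^esub> f) x = FMor G g (FMor G f x)) \<and>
    (\<forall>X Y. \<forall>f\<in>Hom A X Y. \<forall>g\<in>Hom A X Y. \<forall>x\<in>carrier (FObj G X).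
      FMor G (f \<boxplus>\<^bsub>A\<^esub> g) x = FMor G f x \<otimes>\<^bsub>FObj G Y\<^esub> FMor G g x)"

text \<open>Exactness, at the middle group, of the image of \<open>f\<close>, \<open>g\<close> (with \<open>Cod f = Dom g\<close>) under a
  functor. The lists of \<^const>\<open>exact_seq\<close> are read from right to left.\<close>

definition contra_exact_at ::
  "('o, 'm) cat \<Rightarrow> ('o, 'm, 'g) functor_to_Ab \<Rightarrow> 'm \<Rightarrow> 'm \<Rightarrow> bool" where
  "contra_exact_at A F f g \<longleftrightarrow>
    exact_seq ([FObj F (Dom A f), FObj F (Cod A f), FObj F (Cod A g)], [FMor F f, FMor F g])"

definition co_exact_at ::
  "('o, 'm) cat \<Rightarrow> ('o, 'm, 'g) functor_to_Ab \<Rightarrow> 'm \<Rightarrow> 'm \<Rightarrow> bool" where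
  "co_exact_at A G f g \<longleftrightarrow>
    exact_seq ([FObj G (Cod A g), FObj G (Cod A f), FObj G (Dom A f)], [FMor G g, FMor G f])"

definition Hom_into :: "('o, 'm) cat \<Rightarrow> 'o \<Rightarrow> ('o, 'm, 'm) functor_to_Ab" where
  "Hom_into A V = \<lparr>FObj = (\<lambda>X. hom_group A X V), FMor = (\<lambda>f g. g \<cdot>\<^bsub>A\<^esub> f)\<rparr>"

definition Hom_from :: "('o, 'm) cat \<Rightarrow> 'o \<Rightarrow> ('o, 'm, 'm) functor_to_Ab" where
  "Hom_from A W = \<lparr>FObj = (\<lambda>X. hom_group A W X), FMor = (\<lambda>f g. f \<cdot>\<^bsub>A\<^esub> g)\<rparr>"

definition half_Hom_into_exact ::
  "('o, 'm) cat \<Rightarrow> 'o set \<Rightarrow> ('o, 'm, 'g) functor_to_Ab \<Rightarrow> bool" where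
  "half_Hom_into_exact A \<V> F \<longleftrightarrow>
    (\<forall>i p. short_exact A i p \<and>
       (\<forall>V\<in>\<V>. successively (contra_exact_at A (Hom_into A V)) (ses A i p)) \<longrightarrow>
       contra_exact_at A F i p)"

definition half_Hom_from_exact ::
  "('o, 'm) cat \<Rightarrow> 'o set \<Rightarrow> ('o, 'm, 'g) functor_to_Ab \<Rightarrow> bool" where
  "half_Hom_from_exact A \<W> G \<longleftrightarrow>
    (\<forall>i p. short_exact A i p \<and>
       (\<forall>W\<in>\<W>. successively (co_exact_at A (Hom_from A W)) (ses A i p)) \<longrightarrow>
       co_exact_at A G i p)"


section \<open>Yoneda Ext and special preenveloping and precovering subcategories\<close>

text \<open>Full subcategories are given by their sets of objects.\<close>

definition additive_subcategory :: "('o, 'm) cat \<Rightarrow> 'o set \<Rightarrow> bool" where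
  "additive_subcategory A \<V> \<longleftrightarrow>
    \<V> \<subseteq> Obj A \<and>
    (\<forall>f. isomorphism A f \<and> Dom A f \<in> \<V> \<longrightarrow> Cod A f \<in> \<V>) \<and>
    (\<exists>Z\<in>\<V>. is_zero_object A Z) \<and>
    (\<forall>X\<in>\<V>. \<forall>Y\<in>\<V>. \<exists>S\<in>\<V>. \<exists>i1 i2 p1 p2. is_biproduct A X Y S i1 i2 p1 p2)"

text \<open>Extensions \<open>0 \<rightarrow> N \<rightarrow> E \<rightarrow> M \<rightarrow> 0\<close>, that is, representatives of elements of \<open>Ext\<^sup>1(M, N)\<close>.\<close>

definition extensions :: "('o, 'm) cat \<Rightarrow> 'o \<Rightarrow> 'o \<Rightarrow> ('m \<times> 'm) set" where
  "extensions A M N = {(i, p). short_exact A i p \<and> Dom A i = N \<and> Cod A p = M}"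

definition ext_equiv :: "('o, 'm) cat \<Rightarrow> 'o \<Rightarrow> 'o \<Rightarrow> (('m \<times> 'm) \<times> ('m \<times> 'm)) set" where
  "ext_equiv A M N = {((i, p), (i', p')).
    (i, p) \<in> extensions A M N \<and> (i', p') \<in> extensions A M N \<and>
    (\<exists>\<phi>. isomorphism A \<phi> \<and> Dom A \<phi> = Cod A i \<and> Cod A \<phi> = Cod A i' \<and>
         \<phi> \<cdot>\<^bsub>A\<^esub> i = i' \<and> p' \<cdot>\<^bsub>A\<^esub> \<phi> = p)}"

definition Ext1 :: "('o, 'm) cat \<Rightarrow> 'o \<Rightarrow> 'o \<Rightarrow> ('m \<times> 'm) set set" where
  "Ext1 A M N = extensions A M N // ext_equiv A M N"

text \<open>The neutral element for the Baer sum is the class of \<open>0 \<rightarrow> N \<rightarrow> N \<oplus> M \<rightarrow> M \<rightarrow> 0\<close>; the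
  group \<open>Ext\<^sup>1(M, N)\<close> vanishes if it has no other element.\<close>

definition Ext1_zero :: "('o, 'm) cat \<Rightarrow> 'o \<Rightarrow> 'o \<Rightarrow> ('m \<times> 'm) set" where
  "Ext1_zero A M N =
    ext_equiv A M N `` {(i1, p2). \<exists>S i2 p1. is_biproduct A N M S i1 i2 p1 p2}"

definition left_perp :: "('o, 'm) cat \<Rightarrow> 'o set \<Rightarrow> 'o set" where
  "left_perp A \<V> = {M \<in> Obj A. \<forall>V\<in>\<V>. Ext1 A M V = {Ext1_zero A M V}}"

definition right_perp :: "('o, 'm) cat \<Rightarrow> 'o set \<Rightarrow> 'o set" where
  "right_perp A \<W> = {N \<in> Obj A. \<forall>W\<in>\<W>. Ext1 A W N = {Ext1_zero A W N}}"

definition special_preenveloping :: "('o, 'm) cat \<Rightarrow> 'o set \<Rightarrow> bool" where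
  "special_preenveloping A \<V> \<longleftrightarrow>
    additive_subcategory A \<V> \<and>
    (\<forall>M\<in>Obj A. \<exists>i p. short_exact A i p \<and> Dom A i = M \<and> Cod A i \<in> \<V> \<and>
       Cod A p \<in> left_perp A \<V>)"

definition special_precovering :: "('o, 'm) cat \<Rightarrow> 'o set \<Rightarrow> bool" where
  "special_precovering A \<W> \<longleftrightarrow>
    additive_subcategory A \<W> \<and>
    (\<forall>M\<in>Obj A. \<exists>i p. short_exact A i p \<and> Cod A p = M \<and> Dom A p \<in> \<W> \<and>
       Dom A i \<in> right_perp A \<W>)"


section \<open>Proper (co)resolutions and stable functors\<close>

text \<open>
  A coresolution \<open>0 \<rightarrow> M \<rightarrow> I\<^sup>0 \<rightarrow> I\<^sup>1 \<rightarrow> \<dots>\<close> is given by the sequence of its maps: \<open>\<delta> 0\<close> is the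
  augmentation \<open>M \<rightarrow> I\<^sup>0\<close> and \<open>\<delta> (Suc j) : I\<^sup>j \<rightarrow> I\<^sup>j\<^sup>+\<^sup>1\<close>, so \<open>I\<^sup>j = Cod (\<delta> j)\<close>. The sequence
  \<open>case_nat z \<delta>\<close> is \<open>\<delta>\<close> with the map \<open>z : 0 \<rightarrow> M\<close> put in front.
\<close>

definition proper_coresolution ::
  "('o, 'm) cat \<Rightarrow> 'o set \<Rightarrow> 'o \<Rightarrow> (nat \<Rightarrow> 'm) \<Rightarrow> bool" where
  "proper_coresolution A \<V> M \<delta> \<longleftrightarrow>
    Dom A (\<delta> 0) = M \<and> (\<forall>j. Cod A (\<delta> j) \<in> \<V>) \<and>
    (let e = case_nat (Zero A (zero_object A) M) \<delta> in
      (\<forall>n. exact_at A (e n) (e (Suc n))) \<and>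
      (\<forall>V\<in>\<V>. \<forall>n. contra_exact_at A (Hom_into A V) (e n) (e (Suc n))))"

text \<open>Dually, \<open>\<pi> 0 : P\<^sub>0 \<rightarrow> N\<close> and \<open>\<pi> (Suc j) : P\<^sub>j\<^sub>+\<^sub>1 \<rightarrow> P\<^sub>j\<close>, so \<open>P\<^sub>j = Dom (\<pi> j)\<close>.\<close>

definition proper_resolution ::
  "('o, 'm) cat \<Rightarrow> 'o set \<Rightarrow> 'o \<Rightarrow> (nat \<Rightarrow> 'm) \<Rightarrow> bool" where
  "proper_resolution A \<W> N \<pi> \<longleftrightarrow>
    Cod A (\<pi> 0) = N \<and> (\<forall>j. Dom A (\<pi> j) \<in> \<W>) \<and>
    (let e = case_nat (Zero A N (zero_object A)) \<pi> in
      (\<forall>n. exact_at A (e (Suc n)) (e n)) \<and>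
      (\<forall>W\<in>\<W>. \<forall>n. co_exact_at A (Hom_from A W) (e (Suc n)) (e n)))"

text \<open>A choice of a proper (co)resolution for every object.\<close>

definition proper_coresolutions ::
  "('o, 'm) cat \<Rightarrow> 'o set \<Rightarrow> ('o \<Rightarrow> nat \<Rightarrow> 'm) \<Rightarrow> bool" where
  "proper_coresolutions A \<V> I \<longleftrightarrow> (\<forall>M\<in>Obj A. proper_coresolution A \<V> M (I M))"

definition proper_resolutions ::
  "('o, 'm) cat \<Rightarrow> 'o set \<Rightarrow> ('o \<Rightarrow> nat \<Rightarrow> 'm) \<Rightarrow> bool" where
  "proper_resolutions A \<W> P \<longleftrightarrow> (\<forall>N\<in>Obj A. proper_resolution A \<W> N (P N))"

definition group_coker :: "'a monoid \<Rightarrow> 'b monoid \<Rightarrow> ('a \<Rightarrow> 'b) \<Rightarrow> 'b set monoid" where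
  "group_coker K H h = H Mod (h ` carrier K)"

definition L0_contra ::
  "('o, 'm) cat \<Rightarrow> ('o, 'm, 'g) functor_to_Ab \<Rightarrow> (nat \<Rightarrow> 'm) \<Rightarrow> 'g set monoid" where
  "L0_contra A F \<delta> = group_coker (FObj F (Cod A (\<delta> 1))) (FObj F (Cod A (\<delta> 0))) (FMor F (\<delta> 1))"

definition L0_co ::
  "('o, 'm) cat \<Rightarrow> ('o, 'm, 'g) functor_to_Ab \<Rightarrow> (nat \<Rightarrow> 'm) \<Rightarrow> 'g set monoid" where
  "L0_co A G \<pi> = group_coker (FObj G (Dom A (\<pi> 1))) (FObj G (Dom A (\<pi> 0))) (FMor G (\<pi> 1))"

text \<open>The map out of the cokernel \<open>L\<^sub>0\<close> induced by the image of the augmentation, which is constant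
  on cosets; it serves both variances.\<close>

definition rho :: "('o, 'm, 'g) functor_to_Ab \<Rightarrow> (nat \<Rightarrow> 'm) \<Rightarrow> 'g set \<Rightarrow> 'g" where
  "rho F \<delta> X = the_elem (FMor F (\<delta> 0) ` X)"

text \<open>
  The cokernel of a natural transformation is formed objectwise; for \<open>f : M \<rightarrow> N\<close>, the map induced
  by \<open>F f\<close> on cokernels sends the coset \<open>X\<close> to the coset generated by the elements \<open>F f x\<close>
  with \<open>x \<in> X\<close>.
\<close>

definition stable_contra ::
  "('o, 'm) cat \<Rightarrow> ('o, 'm, 'g) functor_to_Ab \<Rightarrow> ('o \<Rightarrow> nat \<Rightarrow> 'm) \<Rightarrow>
    ('o, 'm, 'g set) functor_to_Ab" where
  "stable_contra A F I = \<lparr>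
    FObj = (\<lambda>M. group_coker (L0_contra A F (I M)) (FObj F M) (rho F (I M))),
    FMor = (\<lambda>f X. rho F (I (Dom A f)) ` carrier (L0_contra A F (I (Dom A f)))
                    <#>\<^bsub>FObj F (Dom A f)\<^esub> FMor F f ` X)\<rparr>"

definition stable_co ::
  "('o, 'm) cat \<Rightarrow> ('o, 'm, 'g) functor_to_Ab \<Rightarrow> ('o \<Rightarrow> nat \<Rightarrow> 'm) \<Rightarrow>
    ('o, 'm, 'g set) functor_to_Ab" where
  "stable_co A G P = \<lparr>
    FObj = (\<lambda>N. group_coker (L0_co A G (P N)) (FObj G N) (rho G (P N))),
    FMor = (\<lambda>f X. rho G (P (Cod A f)) ` carrier (L0_co A G (P (Cod A f)))
                    <#>\<^bsub>FObj G (Cod A f)\<^esub> FMor G f ` X)\<rparr>"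


section \<open>Existence of proper (co)resolutions\<close>

text \<open>
  If \<open>\<V>\<close> is special preenveloping, then every object has a proper \<open>\<V>\<close>-coresolution, and dually.
  So the choices over which statements about stable functors quantify always exist.
\<close>

context category begin

lemma HomI [intro]: "f \<in> Mor A \<Longrightarrow> f \<in> Hom A (Dom A f) (Cod A f)"
  by (simp add: Hom_def)

lemma Hom_iff: "f \<in> Hom A X Y \<longleftrightarrow> f \<in> Mor A \<and> Dom A f = X \<and> Cod A f = Y"
  by (simp add: Hom_def)

lemma Id_simps [simp]:
  "X \<in> Obj A \<Longrightarrow> Id A X \<in> Mor A" "X \<in> Obj A \<Longrightarrow> Dom A (Id A X) = X" "X \<in> Obj A \<Longrightarrow> Cod A (Id A X) = X"
  using Id_Hom by (auto simp: Hom_iff)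

lemma comp_simps [simp]:
  assumes "f \<in> Mor A" "g \<in> Mor A" "Cod A f = Dom A g"
  shows "g \<cdot> f \<in> Mor A" "Dom A (g \<cdot> f) = Dom A f" "Cod A (g \<cdot> f) = Cod A g"
  using comp_Hom[of f "Dom A f" "Cod A f" g "Cod A g"] assms by (auto simp: Hom_iff)

lemma assoc [simp]:
  "\<lbrakk>f \<in> Mor A; g \<in> Mor A; h \<in> Mor A; Cod A f = Dom A g; Cod A g = Dom A h\<rbrakk> \<Longrightarrow> h \<cdot> g \<cdot> f = h \<cdot> (g \<cdot> f)"
  using comp_assoc by (simp add: Hom_iff)

lemma comp_Id [simp]:
  "\<lbrakk>f \<in> Mor A; Cod A f = Y\<rbrakk> \<Longrightarrow> Id A Y \<cdot> f = f" "\<lbrakk>f \<in> Mor A; Dom A f = X\<rbrakk> \<Longrightarrow> f \<cdot> Id A X = f"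
  using comp_Id_left comp_Id_right by (auto simp: Hom_iff)

lemma is_kernelD:
  assumes "is_kernel A k f"
  shows "k \<in> Mor A" "f \<in> Mor A" "Cod A k = Dom A f" "f \<cdot> k = Zero A (Dom A k) (Cod A f)"
  using assms by (auto simp: is_kernel_def)

lemma is_kernel_ex:
  assumes "is_kernel A k f" "h \<in> Mor A" "Cod A h = Dom A f" "f \<cdot> h = Zero A (Dom A h) (Cod A f)"
  obtains u where "u \<in> Mor A" "Dom A u = Dom A h" "Cod A u = Dom A k" "k \<cdot> u = h"
  using assms unfolding is_kernel_def Hom_iff by metis

lemma is_cokernelD:
  assumes "is_cokernel A c f"
  shows "c \<in> Mor A" "f \<in> Mor A" "Dom A c = Cod A f" "c \<cdot> f = Zero A (Dom A f) (Cod A c)"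
  using assms by (auto simp: is_cokernel_def)

lemma is_cokernel_ex:
  assumes "is_cokernel A c f" "h \<in> Mor A" "Dom A h = Cod A f" "h \<cdot> f = Zero A (Dom A f) (Cod A h)"
  obtains u where "u \<in> Mor A" "Dom A u = Cod A c" "Cod A u = Cod A h" "u \<cdot> c = h"
  using assms unfolding is_cokernel_def Hom_iff by metis

lemma monicD:
  "\<lbrakk>monic A m; g \<in> Mor A; h \<in> Mor A; Cod A g = Dom A m; Cod A h = Dom A m; Dom A g = Dom A h; m \<cdot> g = m \<cdot> h\<rbrakk> \<Longrightarrow> g = h"
  unfolding monic_def by (metis HomI)

lemma epicD:
  "\<lbrakk>epic A e; g \<in> Mor A; h \<in> Mor A; Dom A g = Cod A e; Dom A h = Cod A e; Cod A g = Cod A h; g \<cdot> e = h \<cdot> e\<rbrakk> \<Longrightarrow> g = h"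
  unfolding epic_def by (metis HomI)

end

context preadditive_category begin

lemma Zero_simps [simp]:
  assumes "X \<in> Obj A" "Y \<in> Obj A"
  shows "Zero A X Y \<in> Mor A" "Dom A (Zero A X Y) = X" "Cod A (Zero A X Y) = Y"
proof -
  interpret H: comm_group "hom_group A X Y" using comm_group_hom_group assms .
  have "Zero A X Y \<in> Hom A X Y" using H.one_closed by (simp add: hom_group_def)
  then show "Zero A X Y \<in> Mor A" "Dom A (Zero A X Y) = X" "Cod A (Zero A X Y) = Y" by (auto simp: Hom_iff)
qed

lemma add_simps [simp]:
  assumes "f \<in> Mor A" "g \<in> Mor A" "Dom A f = Dom A g" "Cod A f = Cod A g"
  shows "f \<boxplus> g \<in> Mor A" "Dom A (f \<boxplus> g) = Dom A g" "Cod A (f \<boxplus> g) = Cod A g"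
proof -
  interpret H: comm_group "hom_group A (Dom A g) (Cod A g)" using comm_group_hom_group assms by simp
  have "f \<boxplus> g \<in> Hom A (Dom A g) (Cod A g)" using H.m_closed[of f g] assms by (simp add: hom_group_def Hom_iff)
  then show "f \<boxplus> g \<in> Mor A" "Dom A (f \<boxplus> g) = Dom A g" "Cod A (f \<boxplus> g) = Cod A g" by (auto simp: Hom_iff)
qed

lemma add_comm: "\<lbrakk>f \<in> Hom A X Y; g \<in> Hom A X Y\<rbrakk> \<Longrightarrow> f \<boxplus> g = g \<boxplus> f"
proof -
  assume a: "f \<in> Hom A X Y" "g \<in> Hom A X Y"
  then interpret H: comm_group "hom_group A X Y" using comm_group_hom_group by (metis Hom_iff Dom_Obj Cod_Obj)
  show ?thesis using H.m_comm[of f g] a by (simp add: hom_group_def)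
qed

lemma add_assoc: "\<lbrakk>f \<in> Hom A X Y; g \<in> Hom A X Y; h \<in> Hom A X Y\<rbrakk> \<Longrightarrow> f \<boxplus> g \<boxplus> h = f \<boxplus> (g \<boxplus> h)"
proof -
  assume a: "f \<in> Hom A X Y" "g \<in> Hom A X Y" "h \<in> Hom A X Y"
  then interpret H: comm_group "hom_group A X Y" using comm_group_hom_group by (metis Hom_iff Dom_Obj Cod_Obj)
  show ?thesis using H.m_assoc[of f g h] a by (simp add: hom_group_def)
qed

lemma add_Zero [simp]:
  "\<lbrakk>f \<in> Mor A; Dom A f = X; Cod A f = Y\<rbrakk> \<Longrightarrow> f \<boxplus> Zero A X Y = f"
  "\<lbrakk>f \<in> Mor A; Dom A f = X; Cod A f = Y\<rbrakk> \<Longrightarrow> Zero A X Y \<boxplus> f = f"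
proof -
  assume a: "f \<in> Mor A" "Dom A f = X" "Cod A f = Y"
  then interpret H: comm_group "hom_group A X Y" using comm_group_hom_group by (metis Dom_Obj Cod_Obj)
  show "f \<boxplus> Zero A X Y = f" "Zero A X Y \<boxplus> f = f" using H.r_one[of f] H.l_one[of f] a by (simp_all add: hom_group_def Hom_iff)
qed

lemma neg_ex:
  assumes "f \<in> Mor A"
  obtains g where "g \<in> Mor A" "Dom A g = Dom A f" "Cod A g = Cod A f" "f \<boxplus> g = Zero A (Dom A f) (Cod A f)"
    "g \<boxplus> f = Zero A (Dom A f) (Cod A f)"
proof -
  interpret H: comm_group "hom_group A (Dom A f) (Cod A f)" using comm_group_hom_group assms by simp
  have f: "f \<in> carrier (hom_group A (Dom A f) (Cod A f))" using assms by (simp add: hom_group_def Hom_iff)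
  show thesis using that[of "inv\<^bsub>hom_group A (Dom A f) (Cod A f)\<^esub> f"] H.r_inv[OF f] H.l_inv[OF f] H.inv_closed[OF f]
    by (simp add: hom_group_def Hom_iff)
qed

lemma add_idem_zero:
  assumes "f \<in> Mor A" "f \<boxplus> f = f" shows "f = Zero A (Dom A f) (Cod A f)"
proof -
  obtain g where g: "g \<in> Mor A" "Dom A g = Dom A f" "Cod A g = Cod A f" "f \<boxplus> g = Zero A (Dom A f) (Cod A f)"
    using neg_ex[OF assms(1)] by metis
  have "f = f \<boxplus> (f \<boxplus> g)" using g assms by simp
  also have "\<dots> = f \<boxplus> f \<boxplus> g" by (rule add_assoc[symmetric]) (use g assms in \<open>auto simp: Hom_iff\<close>)
  finally show ?thesis using assms g by simp
qed

lemma add_comp [simp]: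
  "\<lbrakk>f \<in> Mor A; g \<in> Mor A; h \<in> Mor A; Cod A f = Dom A g; Dom A g = Dom A h; Cod A g = Cod A h\<rbrakk>
    \<Longrightarrow> (g \<boxplus> h) \<cdot> f = g \<cdot> f \<boxplus> h \<cdot> f"
  "\<lbrakk>f \<in> Mor A; g \<in> Mor A; h \<in> Mor A; Cod A f = Dom A h; Dom A g = Dom A f; Cod A g = Cod A f\<rbrakk>
    \<Longrightarrow> h \<cdot> (f \<boxplus> g) = h \<cdot> f \<boxplus> h \<cdot> g"
  using comp_add_left comp_add_right by (auto simp: Hom_iff)

lemma Zero_comp [simp]:
  assumes "f \<in> Mor A" "Cod A f = Y" "Z \<in> Obj A"
  shows "Zero A Y Z \<cdot> f = Zero A (Dom A f) Z"
proof -
  have Y: "Y \<in> Obj A" using assms by auto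
  have "Zero A Y Z \<cdot> f \<boxplus> Zero A Y Z \<cdot> f = Zero A Y Z \<cdot> f"
    using assms Y by (simp flip: add_comp)
  from add_idem_zero[OF _ this] show ?thesis using assms Y by simp
qed

lemma comp_Zero [simp]:
  assumes "f \<in> Mor A" "Dom A f = Y" "X \<in> Obj A"
  shows "f \<cdot> Zero A X Y = Zero A X (Cod A f)"
proof -
  have Y: "Y \<in> Obj A" using assms by auto
  have "f \<cdot> (Zero A X Y \<boxplus> Zero A X Y) = f \<cdot> Zero A X Y \<boxplus> f \<cdot> Zero A X Y"
    by (rule add_comp(2)) (use assms Y in auto)
  then have "f \<cdot> Zero A X Y \<boxplus> f \<cdot> Zero A X Y = f \<cdot> Zero A X Y"
    using assms Y by simp
  from add_idem_zero[OF _ this] show ?thesis using assms Y by simp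
qed

lemma monicI:
  assumes m: "m \<in> Mor A"
    and z: "\<And>x. \<lbrakk>x \<in> Mor A; Cod A x = Dom A m; m \<cdot> x = Zero A (Dom A x) (Cod A m)\<rbrakk> \<Longrightarrow> x = Zero A (Dom A x) (Cod A x)"
  shows "monic A m"
  unfolding monic_def Hom_iff
proof (intro conjI allI ballI impI m)
  fix X g h assume g: "g \<in> Hom A X (Dom A m)" and h: "h \<in> Hom A X (Dom A m)" and e: "m \<cdot> g = m \<cdot> h"
  then have gh: "g \<in> Mor A" "Dom A g = X" "Cod A g = Dom A m" "h \<in> Mor A" "Dom A h = X" "Cod A h = Dom A m"
    by (auto simp: Hom_iff)
  obtain k where k: "k \<in> Mor A" "Dom A k = X" "Cod A k = Dom A m" "h \<boxplus> k = Zero A X (Dom A m)" "k \<boxplus> h = Zero A X (Dom A m)"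
    using neg_ex[of h] gh by metis
  have "m \<cdot> (g \<boxplus> k) = m \<cdot> (h \<boxplus> k)" using gh k(1-3) e m by simp
  also have "\<dots> = Zero A X (Cod A m)" using k m gh by (metis comp_Zero Dom_Obj)
  finally have "g \<boxplus> k = Zero A X (Dom A m)" using z[of "g \<boxplus> k"] gh k by simp
  then have "h = (g \<boxplus> k) \<boxplus> h" using gh by simp
  also have "\<dots> = g \<boxplus> (k \<boxplus> h)" by (rule add_assoc) (use gh k in \<open>auto simp: Hom_iff\<close>)
  finally show "g = h" using k gh by simp
qed

lemma kernel_monic: assumes "is_kernel A k f" shows "monic A k"
proof (rule monicI)
  show "k \<in> Mor A" using assms is_kernelD by blast
  fix x assume x: "x \<in> Mor A" "Cod A x = Dom A k" "k \<cdot> x = Zero A (Dom A x) (Cod A k)"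
  have "\<exists>!u. u \<in> Hom A (Dom A x) (Dom A k) \<and> k \<cdot> u = Zero A (Dom A x) (Cod A k)"
  proof -
    let ?h = "Zero A (Dom A x) (Cod A k)"
    have h: "?h \<in> Mor A" "Cod A ?h = Dom A f" "f \<cdot> ?h = Zero A (Dom A ?h) (Cod A f)" "Dom A ?h = Dom A x"
      using x is_kernelD[OF assms] by auto
    then show ?thesis using assms unfolding is_kernel_def by metis
  qed
  moreover have "x \<in> Hom A (Dom A x) (Dom A k)" using x by (simp add: Hom_iff)
  moreover have "Zero A (Dom A x) (Dom A k) \<in> Hom A (Dom A x) (Dom A k)" using x is_kernelD[OF assms] by (simp add: Hom_iff)
  moreover have "k \<cdot> Zero A (Dom A x) (Dom A k) = Zero A (Dom A x) (Cod A k)" using x is_kernelD[OF assms] by simp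
  ultimately show "x = Zero A (Dom A x) (Cod A x)" using x by metis
qed

lemma cokernel_epic: assumes "is_cokernel A c f" shows "epic A c"
  unfolding epic_def
proof (intro conjI allI ballI impI)
  note D = is_cokernelD[OF assms]
  show "c \<in> Mor A" by (fact D)
  fix X g h assume g: "g \<in> Hom A (Cod A c) X" and h: "h \<in> Hom A (Cod A c) X" and e: "g \<cdot> c = h \<cdot> c"
  have "\<exists>!u. u \<in> Hom A (Cod A c) (Cod A (g \<cdot> c)) \<and> u \<cdot> c = g \<cdot> c"
  proof -
    have "g \<cdot> c \<cdot> f = Zero A (Dom A f) (Cod A (g \<cdot> c))" using g D by (auto simp: Hom_iff)
    moreover have "g \<cdot> c \<in> Mor A" "Dom A (g \<cdot> c) = Cod A f" using g D by (auto simp: Hom_iff)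
    ultimately show ?thesis using assms unfolding is_cokernel_def by metis
  qed
  moreover have "Cod A (g \<cdot> c) = X" using g D by (auto simp: Hom_iff)
  ultimately show "g = h" using g h e by metis
qed

lemma is_kernelI:
  assumes "monic A k" "f \<in> Mor A" "Cod A k = Dom A f" "f \<cdot> k = Zero A (Dom A k) (Cod A f)"
    and "\<And>h. \<lbrakk>h \<in> Mor A; Cod A h = Dom A f; f \<cdot> h = Zero A (Dom A h) (Cod A f)\<rbrakk> \<Longrightarrow> \<exists>u\<in>Hom A (Dom A h) (Dom A k). k \<cdot> u = h"
  shows "is_kernel A k f"
  using assms unfolding is_kernel_def monic_def by metis

lemma is_cokernelI:
  assumes "epic A c" "f \<in> Mor A" "Dom A c = Cod A f" "c \<cdot> f = Zero A (Dom A f) (Cod A c)"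
    and "\<And>h. \<lbrakk>h \<in> Mor A; Dom A h = Cod A f; h \<cdot> f = Zero A (Dom A f) (Cod A h)\<rbrakk> \<Longrightarrow> \<exists>u\<in>Hom A (Cod A c) (Cod A h). u \<cdot> c = h"
  shows "is_cokernel A c f"
  using assms unfolding is_cokernel_def epic_def by metis

lemma kernel_of_cokernel:
  assumes k: "is_kernel A m f" and c: "is_cokernel A c m" shows "is_kernel A m c"
proof (rule is_kernelI[OF kernel_monic[OF k]])
  note D = is_kernelD[OF k] is_cokernelD[OF c]
  show "c \<in> Mor A" "Cod A m = Dom A c" "c \<cdot> m = Zero A (Dom A m) (Cod A c)" using D by auto
  fix h assume h: "h \<in> Mor A" "Cod A h = Dom A c" "c \<cdot> h = Zero A (Dom A h) (Cod A c)"
  obtain t where t: "t \<in> Mor A" "Dom A t = Cod A c" "Cod A t = Cod A f" "t \<cdot> c = f"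
    using is_cokernel_ex[OF c, of f] D by metis
  have "f \<cdot> h = t \<cdot> (c \<cdot> h)" using t D h by (metis assoc)
  then have "f \<cdot> h = Zero A (Dom A h) (Cod A f)" using t D h by simp
  then show "\<exists>u\<in>Hom A (Dom A h) (Dom A m). m \<cdot> u = h"
    using is_kernel_ex[OF k h(1)] h D by (metis Hom_iff)
qed

lemma cokernel_of_kernel:
  assumes k: "is_cokernel A e f" and c: "is_kernel A m e" shows "is_cokernel A e m"
proof (rule is_cokernelI[OF cokernel_epic[OF k]])
  note D = is_cokernelD[OF k] is_kernelD[OF c]
  show "m \<in> Mor A" "Dom A e = Cod A m" "e \<cdot> m = Zero A (Dom A m) (Cod A e)" using D by auto
  fix h assume h: "h \<in> Mor A" "Dom A h = Cod A m" "h \<cdot> m = Zero A (Dom A m) (Cod A h)"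
  obtain t where t: "t \<in> Mor A" "Dom A t = Dom A f" "Cod A t = Dom A m" "m \<cdot> t = f"
    using is_kernel_ex[OF c, of f] D by metis
  have "h \<cdot> f = h \<cdot> m \<cdot> t" using t D h by (metis assoc)
  then have "h \<cdot> f = Zero A (Dom A f) (Cod A h)" using t D h by simp
  then show "\<exists>u\<in>Hom A (Cod A e) (Cod A h). u \<cdot> e = h"
    using is_cokernel_ex[OF k h(1)] h D by (metis Hom_iff)
qed

lemma exact_at_iff:
  "exact_at A f g \<longleftrightarrow> (\<exists>m c. is_cokernel A c f \<and> is_kernel A m c \<and> is_kernel A m g)"
  by (auto simp: exact_at_def is_image_def)

lemma exact_at_Mor:
  assumes "exact_at A f g" shows "f \<in> Mor A" "g \<in> Mor A" "Cod A f = Dom A g"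
    "g \<cdot> f = Zero A (Dom A f) (Cod A g)"
proof -
  obtain m c where k: "is_cokernel A c f" "is_kernel A m c" "is_kernel A m g"
    using assms exact_at_iff by blast
  note D = is_cokernelD[OF k(1)] is_kernelD[OF k(2)] is_kernelD[OF k(3)]
  show "f \<in> Mor A" "g \<in> Mor A" "Cod A f = Dom A g" using D by auto
  obtain t where t: "t \<in> Mor A" "Dom A t = Dom A f" "Cod A t = Dom A m" "m \<cdot> t = f"
    using is_kernel_ex[OF k(2), of f] D by metis
  have "g \<cdot> f = g \<cdot> m \<cdot> t" using t D by (metis assoc)
  then show "g \<cdot> f = Zero A (Dom A f) (Cod A g)" using t D by simp
qed

end

context abelian_category begin

lemma is_zero_zero_object: "is_zero_object A (zero_object A)"
  unfolding zero_object_def using zero_object_exists by (rule someI_ex)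

lemma zero_object_Obj [simp]: "zero_object A \<in> Obj A"
  using is_zero_zero_object by (simp add: is_zero_object_def)

lemma into_zero_object:
  "\<lbrakk>f \<in> Mor A; Cod A f = zero_object A\<rbrakk> \<Longrightarrow> f = Zero A (Dom A f) (zero_object A)"
  using is_zero_zero_object unfolding is_zero_object_def
  by (metis Dom_Obj HomI Zero_simps zero_object_Obj)

lemma from_zero_object:
  "\<lbrakk>f \<in> Mor A; Dom A f = zero_object A\<rbrakk> \<Longrightarrow> f = Zero A (zero_object A) (Cod A f)"
  using is_zero_zero_object unfolding is_zero_object_def
  by (metis Cod_Obj HomI Zero_simps zero_object_Obj)

lemma Id_monic: "X \<in> Obj A \<Longrightarrow> monic A (Id A X)" and Id_epic: "X \<in> Obj A \<Longrightarrow> epic A (Id A X)"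
  by (auto simp: monic_def epic_def Hom_iff)

lemma exact_from_zero_iff:
  assumes "m \<in> Mor A" 
  shows "exact_at A (Zero A (zero_object A) (Dom A m)) m \<longleftrightarrow> monic A m"
proof
  assume e: "exact_at A (Zero A (zero_object A) (Dom A m)) m"
  then obtain k c where k: "is_cokernel A c (Zero A (zero_object A) (Dom A m))" "is_kernel A k c" "is_kernel A k m"
    using exact_at_iff by blast
  note D = is_cokernelD[OF k(1)] is_kernelD[OF k(2)] is_kernelD[OF k(3)]
  obtain u where u: "u \<in> Mor A" "Dom A u = Cod A c" "Cod A u = Dom A m" "u \<cdot> c = Id A (Dom A m)"
    using is_cokernel_ex[OF k(1), of "Id A (Dom A m)"] assms by auto
  show "monic A m"
  proof (rule monicI[OF assms])
    fix x assume x: "x \<in> Mor A" "Cod A x = Dom A m" "m \<cdot> x = Zero A (Dom A x) (Cod A m)"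
    obtain t where t: "t \<in> Mor A" "Dom A t = Dom A x" "Cod A t = Dom A k" "k \<cdot> t = x"
      using is_kernel_ex[OF k(3), of x] x by metis
    have "c \<cdot> x = c \<cdot> k \<cdot> t" using t D assms by (metis assoc)
    then have cx: "c \<cdot> x = Zero A (Dom A x) (Cod A c)" using t D by simp
    have "x = u \<cdot> c \<cdot> x" using u x by simp
    also have "\<dots> = u \<cdot> (c \<cdot> x)" by (rule assoc) (use u x D assms in auto)
    also have "\<dots> = Zero A (Dom A x) (Cod A x)" using cx u x by simp
    finally show "x = Zero A (Dom A x) (Cod A x)" .
  qed
next
  assume m: "monic A m"
  let ?z = "Zero A (zero_object A) (Dom A m)" let ?c = "Id A (Dom A m)"
  have z: "?z \<in> Mor A" "Dom A ?z = zero_object A" "Cod A ?z = Dom A m" "Dom A m \<in> Obj A" "Cod A m \<in> Obj A" using assms by auto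
  have zm: "monic A ?z" by (rule monicI) (use z into_zero_object in auto)
  have "is_cokernel A ?c ?z" by (rule is_cokernelI[OF Id_epic]) (use assms z in \<open>auto simp: Hom_iff\<close>)
  moreover have "is_kernel A ?z ?c"
  proof (rule is_kernelI[OF zm])
    fix h assume h: "h \<in> Mor A" "Cod A h = Dom A ?c" "?c \<cdot> h = Zero A (Dom A h) (Cod A ?c)"
    then have "h = Zero A (Dom A h) (Dom A m)" using assms by simp
    then show "\<exists>u\<in>Hom A (Dom A h) (Dom A ?z). ?z \<cdot> u = h"
      using h z by (intro bexI[of _ "Zero A (Dom A h) (zero_object A)"]) (auto simp: Hom_iff)
  qed (use assms in auto)
  moreover have "is_kernel A ?z m"
  proof (rule is_kernelI[OF zm])
    fix h assume h: "h \<in> Mor A" "Cod A h = Dom A m" "m \<cdot> h = Zero A (Dom A h) (Cod A m)"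
    then have "h = Zero A (Dom A h) (Dom A m)" using monicD[OF m, of h "Zero A (Dom A h) (Dom A m)"] assms by simp
    then show "\<exists>u\<in>Hom A (Dom A h) (Dom A ?z). ?z \<cdot> u = h"
      using h z by (intro bexI[of _ "Zero A (Dom A h) (zero_object A)"]) (auto simp: Hom_iff)
  qed (use assms in auto)
  ultimately show "exact_at A ?z m" unfolding exact_at_iff by blast
qed

lemma exact_to_zero_iff:
  assumes "e \<in> Mor A"
  shows "exact_at A e (Zero A (Cod A e) (zero_object A)) \<longleftrightarrow> epic A e"
proof
  let ?z = "Zero A (Cod A e) (zero_object A)"
  have z: "?z \<in> Mor A" "Dom A ?z = Cod A e" "Cod A ?z = zero_object A" "Dom A e \<in> Obj A" "Cod A e \<in> Obj A" using assms by auto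
  {
    assume "exact_at A e ?z"
    then obtain k c where k: "is_cokernel A c e" "is_kernel A k c" "is_kernel A k ?z"
      using exact_at_iff by blast
    note D = is_cokernelD[OF k(1)] is_kernelD[OF k(2)] is_kernelD[OF k(3)]
    obtain u where u: "u \<in> Mor A" "Dom A u = Cod A e" "Cod A u = Dom A k" "k \<cdot> u = Id A (Cod A e)"
      using is_kernel_ex[OF k(3), of "Id A (Cod A e)"] z assms by (auto simp del: Zero_simps)
    have "c = c \<cdot> (k \<cdot> u)" using u D by simp
    also have "\<dots> = c \<cdot> k \<cdot> u" by (rule assoc[symmetric]) (use u D assms in auto)
    also have "\<dots> = Zero A (Cod A e) (Cod A c)" using u D by simp
    finally have c0: "c = Zero A (Cod A e) (Cod A c)" .
    show "epic A e" unfolding epic_def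
    proof (intro conjI allI ballI impI assms)
      fix X g h assume g: "g \<in> Hom A (Cod A e) X" and h: "h \<in> Hom A (Cod A e) X" and eq: "g \<cdot> e = h \<cdot> e"
      then have gh: "g \<in> Mor A" "Dom A g = Cod A e" "Cod A g = X" "h \<in> Mor A" "Dom A h = Cod A e" "Cod A h = X"
        by (auto simp: Hom_iff)
      obtain n where n: "n \<in> Mor A" "Dom A n = Cod A e" "Cod A n = X" "h \<boxplus> n = Zero A (Cod A e) X" "n \<boxplus> h = Zero A (Cod A e) X"
        using neg_ex[of h] gh by metis
      have "(g \<boxplus> n) \<cdot> e = (h \<boxplus> n) \<cdot> e" using gh n(1-3) eq assms by simp
      also have "\<dots> = Zero A (Dom A e) X" using n(4) assms gh by (metis Zero_comp Cod_Obj)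
      finally have "(g \<boxplus> n) \<cdot> e = Zero A (Dom A e) X" .
      then obtain t where t: "t \<in> Mor A" "Dom A t = Cod A c" "Cod A t = X" "t \<cdot> c = g \<boxplus> n"
        using is_cokernel_ex[OF k(1), of "g \<boxplus> n"] gh n by auto
      then have "g \<boxplus> n = Zero A (Cod A e) X" using c0 z by (metis comp_Zero Cod_Obj Dom_Obj)
      then have "h = (g \<boxplus> n) \<boxplus> h" using gh by simp
      also have "\<dots> = g \<boxplus> (n \<boxplus> h)" by (rule add_assoc) (use gh n in \<open>auto simp: Hom_iff\<close>)
      finally show "g = h" using n gh by simp
    qed
  next
    assume e: "epic A e"
    let ?k = "Id A (Cod A e)"
    have ze: "epic A ?z" unfolding epic_def
      using z by (auto simp: Hom_iff) (metis from_zero_object)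
    have "is_cokernel A ?z e"
    proof (rule is_cokernelI[OF ze])
      fix h assume h: "h \<in> Mor A" "Dom A h = Cod A e" "h \<cdot> e = Zero A (Dom A e) (Cod A h)"
      then have "h = Zero A (Cod A e) (Cod A h)" using epicD[OF e, of h "Zero A (Cod A e) (Cod A h)"] assms by simp
      then show "\<exists>u\<in>Hom A (Cod A ?z) (Cod A h). u \<cdot> ?z = h"
        using h z by (intro bexI[of _ "Zero A (zero_object A) (Cod A h)"]) (auto simp: Hom_iff)
    qed (use assms in auto)
    moreover have "is_kernel A ?k ?z"
      by (rule is_kernelI[OF Id_monic]) (use assms z in \<open>auto simp: Hom_iff\<close>)
    ultimately show "exact_at A e ?z" unfolding exact_at_iff by blast
  }
qed

end


context abelian_category begin

lemma short_exact_iff: "short_exact A i p \<longleftrightarrow> is_kernel A i p \<and> is_cokernel A p i"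
proof
  assume "short_exact A i p"
  then have e: "exact_at A (Zero A (zero_object A) (Dom A i)) i" "exact_at A i p"
    "exact_at A p (Zero A (Cod A p) (zero_object A))" by (auto simp: short_exact_def ses_def)
  note E = exact_at_Mor[OF e(2)]
  have m: "monic A i" and ep: "epic A p" using e E exact_from_zero_iff exact_to_zero_iff by auto
  obtain k c where k: "is_cokernel A c i" "is_kernel A k c" "is_kernel A k p"
    using e(2) exact_at_iff by blast
  note D = is_cokernelD[OF k(1)] is_kernelD[OF k(2)] is_kernelD[OF k(3)]
  have ic: "is_kernel A i c" using kernel_of_cokernel k(1) monic_normal[OF m] by blast
  have ip: "is_kernel A i p"
  proof (rule is_kernelI[OF m])
    fix h assume h: "h \<in> Mor A" "Cod A h = Dom A p" "p \<cdot> h = Zero A (Dom A h) (Cod A p)"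
    obtain t where t: "t \<in> Mor A" "Dom A t = Dom A h" "Cod A t = Dom A k" "k \<cdot> t = h"
      using is_kernel_ex[OF k(3), of h] h by metis
    have "c \<cdot> h = c \<cdot> k \<cdot> t" using t D by (metis assoc)
    then have "c \<cdot> h = Zero A (Dom A h) (Cod A c)" using t D by simp
    then show "\<exists>u\<in>Hom A (Dom A h) (Dom A i). i \<cdot> u = h"
      using is_kernel_ex[OF ic h(1)] h D by (metis Hom_iff)
  qed (use E in auto)
  with cokernel_of_kernel epic_normal[OF ep] show "is_kernel A i p \<and> is_cokernel A p i" by blast
next
  assume a: "is_kernel A i p \<and> is_cokernel A p i"
  then have "exact_at A i p" unfolding exact_at_iff by blast
  moreover have "monic A i" "epic A p" using a kernel_monic cokernel_epic by blast+
  ultimately show "short_exact A i p" using is_kernelD[of i p] a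
    by (simp add: short_exact_def ses_def exact_from_zero_iff exact_to_zero_iff)
qed

lemma ext_equiv_refl: "e \<in> extensions A M N \<Longrightarrow> (e, e) \<in> ext_equiv A M N"
proof (cases e)
  fix i p assume e: "e \<in> extensions A M N" "e = (i, p)"
  then have "is_kernel A i p" by (auto simp: extensions_def short_exact_iff)
  note D = is_kernelD[OF this]
  have "isomorphism A (Id A (Cod A i))" using D by (auto simp: isomorphism_def Hom_iff)
  then show ?thesis using e D by (auto simp: ext_equiv_def intro!: exI[of _ "Id A (Cod A i)"])
qed

lemma Ext1_vanishes_retraction:
  assumes se: "short_exact A j q" and v: "Ext1 A (Cod A q) (Dom A j) = {Ext1_zero A (Cod A q) (Dom A j)}"
  obtains r where "r \<in> Mor A" "Dom A r = Cod A j" "Cod A r = Dom A j" "r \<cdot> j = Id A (Dom A j)"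
proof -
  let ?M = "Cod A q" and ?N = "Dom A j"
  have j: "j \<in> Mor A" using se short_exact_iff is_kernelD by blast
  have e: "(j, q) \<in> extensions A ?M ?N" using se by (simp add: extensions_def)
  then have "ext_equiv A ?M ?N `` {(j, q)} \<in> Ext1 A ?M ?N" unfolding Ext1_def by (rule quotientI)
  then have "(j, q) \<in> Ext1_zero A ?M ?N" using v ext_equiv_refl[OF e] by auto
  then obtain i1 p2 S i2 p1 \<phi> where b: "is_biproduct A ?N ?M S i1 i2 p1 p2"
    and \<phi>: "isomorphism A \<phi>" "Dom A \<phi> = Cod A i1" "Cod A \<phi> = Cod A j" "\<phi> \<cdot> i1 = j"
    by (auto simp: Ext1_zero_def ext_equiv_def)
  obtain \<psi> where \<psi>: "\<psi> \<in> Mor A" "Dom A \<psi> = Cod A \<phi>" "Cod A \<psi> = Dom A \<phi>" "\<psi> \<cdot> \<phi> = Id A (Dom A \<phi>)" "\<phi> \<in> Mor A"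
    using \<phi>(1) by (auto simp: isomorphism_def Hom_iff)
  have B: "i1 \<in> Mor A" "Dom A i1 = ?N" "Cod A i1 = S" "p1 \<in> Mor A" "Dom A p1 = S" "Cod A p1 = ?N" "p1 \<cdot> i1 = Id A ?N"
    using b by (auto simp: is_biproduct_def Hom_iff)
  have "\<psi> \<cdot> j = \<psi> \<cdot> \<phi> \<cdot> i1" using \<phi> \<psi> B by (metis assoc)
  then have "\<psi> \<cdot> j = i1" using \<phi> \<psi> B by simp
  then have "p1 \<cdot> \<psi> \<cdot> j = Id A ?N" using B \<psi> \<phi> j by simp
  then show thesis using that[of "p1 \<cdot> \<psi>"] B \<psi> \<phi> by simp
qed

text \<open>Push-out of a short exact sequence along \<open>g\<close>.\<close>

lemma pushout_short_exact:
  assumes se: "short_exact A i p" and g: "g \<in> Mor A" "Dom A g = Dom A i"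
  obtains u j q where "u \<in> Mor A" "Dom A u = Cod A i" "Cod A u = Cod A j" "Dom A j = Cod A g" "Cod A q = Cod A p"
    "short_exact A j q" "u \<cdot> i = j \<cdot> g"
proof -
  have ip: "is_kernel A i p" "is_cokernel A p i" using se short_exact_iff by auto
  note D = is_kernelD[OF ip(1)]
  obtain S i1 i2 p1 p2 where b: "is_biproduct A (Cod A i) (Cod A g) S i1 i2 p1 p2"
    using biproduct_exists[of "Cod A i" "Cod A g"] Cod_Obj[OF D(1)] Cod_Obj[OF g(1)] by metis
  have B: "i1 \<in> Mor A" "Dom A i1 = Dom A p" "Cod A i1 = S" "p1 \<in> Mor A" "Dom A p1 = S" "Cod A p1 = Dom A p"
      "i2 \<in> Mor A" "Dom A i2 = Cod A g" "Cod A i2 = S" "p2 \<in> Mor A" "Dom A p2 = S" "Cod A p2 = Cod A g"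
     "p1 \<cdot> i1 = Id A (Dom A p)" "p2 \<cdot> i2 = Id A (Cod A g)" "p1 \<cdot> i2 = Zero A (Cod A g) (Dom A p)"
     "p2 \<cdot> i1 = Zero A (Dom A p) (Cod A g)"
     "i1 \<cdot> p1 \<boxplus> i2 \<cdot> p2 = Id A S" "S \<in> Obj A"
    using b[unfolded is_biproduct_def Hom_iff] D(1-3) Cod_Obj[of i1] by simp_all
  obtain n where n: "n \<in> Mor A" "Dom A n = Dom A i" "Cod A n = Cod A g" "n \<boxplus> g = Zero A (Dom A i) (Cod A g)"
    using neg_ex[of g] g by metis
  define m where "m = i1 \<cdot> i \<boxplus> i2 \<cdot> n"
  have m: "m \<in> Mor A" "Dom A m = Dom A i" "Cod A m = S" by (simp_all add: m_def B(1-12) D(1-3) n(1-3))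
  have "p1 \<cdot> m = (p1 \<cdot> i1) \<cdot> i \<boxplus> (p1 \<cdot> i2) \<cdot> n"
    unfolding m_def using B(1-12) D n by simp
  then have p1m: "p1 \<cdot> m = i" using B D n by simp
  have im: "monic A i" using ip kernel_monic by blast
  have mm: "monic A m"
  proof (rule monicI[OF m(1)])
    fix x assume x: "x \<in> Mor A" "Cod A x = Dom A m" "m \<cdot> x = Zero A (Dom A x) (Cod A m)"
    have "i \<cdot> x = p1 \<cdot> (m \<cdot> x)" using p1m x m B by (metis assoc)
    then have "i \<cdot> x = Zero A (Dom A x) (Cod A i)" by (simp add: x m B D)
    then show "x = Zero A (Dom A x) (Cod A x)"
      using monicD[OF im, of x "Zero A (Dom A x) (Cod A x)"] x m D by simp
  qed
  obtain c where c: "is_cokernel A c m" using cokernel_exists m by blast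
  note C = is_cokernelD[OF c]
  have mc: "is_kernel A m c" using kernel_of_cokernel[OF _ c] monic_normal[OF mm] by blast
  define u j where "u = c \<cdot> i1" and "j = c \<cdot> i2"
  have u: "u \<in> Mor A" "Dom A u = Dom A p" "Cod A u = Cod A c" by (simp_all add: u_def B(1-3) C(1,3) m(3))
  have j: "j \<in> Mor A" "Dom A j = Cod A g" "Cod A j = Cod A c" by (simp_all add: j_def B(7-9) C(1,3) m(3))
  have cm: "u \<cdot> i \<boxplus> j \<cdot> n = Zero A (Dom A i) (Cod A c)"
    using C(4) m B C D n by (simp add: m_def u_def j_def)
  have "u \<cdot> i = u \<cdot> i \<boxplus> j \<cdot> (n \<boxplus> g)" using u D j n(4) by (metis add_Zero(1) comp_Zero comp_simps Dom_Obj)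
  also have "\<dots> = u \<cdot> i \<boxplus> (j \<cdot> n \<boxplus> j \<cdot> g)" using j n(1-3) g by simp
  also have "\<dots> = u \<cdot> i \<boxplus> j \<cdot> n \<boxplus> j \<cdot> g" by (rule add_assoc[symmetric]) (use u j n g D in \<open>auto simp: Hom_iff\<close>)
  finally have ui: "u \<cdot> i = j \<cdot> g" using cm j g by simp
  have pp: "p \<cdot> p1 \<in> Mor A" "Dom A (p \<cdot> p1) = Cod A m" "Cod A (p \<cdot> p1) = Cod A p"
    using D(2) B(4-6) m(3) by simp_all
  have "p \<cdot> p1 \<cdot> m = p \<cdot> (p1 \<cdot> m)" by (rule assoc) (use D(2) B(4-6) m in simp_all)
  then have "p \<cdot> p1 \<cdot> m = Zero A (Dom A m) (Cod A (p \<cdot> p1))" by (simp add: p1m D(4) m(2) pp(3))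
  then obtain q where q: "q \<in> Mor A" "Dom A q = Cod A c" "Cod A q = Cod A p" "q \<cdot> c = p \<cdot> p1"
    using is_cokernel_ex[OF c pp(1,2)] pp(3) by metis
  have "q \<cdot> j = q \<cdot> c \<cdot> i2" unfolding j_def by (rule assoc[symmetric]) (use q C(1,3) m(3) B(7,9) in simp_all)
  also have "\<dots> = p \<cdot> (p1 \<cdot> i2)" unfolding q(4) by (rule assoc) (use D(2) B(4-9) in simp_all)
  finally have qj: "q \<cdot> j = Zero A (Dom A j) (Cod A q)" by (simp add: B(15) D(2) j(2) q(3) g)
  have "q \<cdot> u = q \<cdot> c \<cdot> i1" unfolding u_def by (rule assoc[symmetric]) (use q C(1,3) m(3) B(1,3) in simp_all)
  also have "\<dots> = p \<cdot> (p1 \<cdot> i1)" unfolding q(4) by (rule assoc) (use D(2) B(1-6) in simp_all)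
  finally have qu: "q \<cdot> u = p" using B(13) D(2) by simp
  have pe: "epic A p" and ce: "epic A c" using cokernel_epic ip c by auto
  have qe: "epic A q" unfolding epic_def
  proof (intro conjI allI ballI impI q)
    fix X a b assume ab: "a \<in> Hom A (Cod A q) X" "b \<in> Hom A (Cod A q) X" "a \<cdot> q = b \<cdot> q"
    then have "a \<cdot> q \<cdot> u = b \<cdot> q \<cdot> u" by simp
    then have "a \<cdot> p = b \<cdot> p" using ab(1,2) q u qu by (auto simp: Hom_iff)
    then show "a = b" using epicD[OF pe, of a b] ab(1,2) q by (auto simp: Hom_iff)
  qed
  have qc: "is_cokernel A q j"
  proof (rule is_cokernelI[OF qe])
    fix h assume h: "h \<in> Mor A" "Dom A h = Cod A j" "h \<cdot> j = Zero A (Dom A j) (Cod A h)"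
    have "h \<cdot> u \<cdot> i = h \<cdot> (j \<cdot> g)" by (simp add: h u j D ui)
    also have "\<dots> = h \<cdot> j \<cdot> g" by (rule assoc[symmetric]) (use h j g in auto)
    finally have "h \<cdot> u \<cdot> i = Zero A (Dom A i) (Cod A (h \<cdot> u))" by (simp add: h(3) j u h g)
    then obtain t where t: "t \<in> Mor A" "Dom A t = Cod A p" "Cod A t = Cod A h" "t \<cdot> p = h \<cdot> u"
      using is_cokernel_ex[OF ip(2), of "h \<cdot> u"] h u j D by (metis comp_simps)
    have "h \<cdot> c = h \<cdot> c \<cdot> (i1 \<cdot> p1 \<boxplus> i2 \<cdot> p2)" by (simp add: B(17) h j C m)
    also have "\<dots> = h \<cdot> (c \<cdot> i1) \<cdot> p1 \<boxplus> h \<cdot> (c \<cdot> i2) \<cdot> p2" by (simp add: B(1-12) h j C m)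
    also have "\<dots> = t \<cdot> p \<cdot> p1" using t(4) h B(1-12) t(1-3) D g unfolding u_def[symmetric] j_def[symmetric] using j u by simp
    also have "\<dots> = t \<cdot> q \<cdot> c" by (simp add: t(1-3) q D B C m)
    finally have hc: "h \<cdot> c = t \<cdot> q \<cdot> c" .
    have "h = t \<cdot> q" by (rule epicD[OF ce _ _ _ _ _ hc]) (use h(1,2) j t(1-3) q(1-3) in simp_all)
    then show "\<exists>u\<in>Hom A (Cod A q) (Cod A h). u \<cdot> q = h" using t q by (auto simp: Hom_iff)
  qed (use q j qj in auto)
  have jm: "monic A j"
  proof (rule monicI[OF j(1)])
    fix x assume x: "x \<in> Mor A" "Cod A x = Dom A j" "j \<cdot> x = Zero A (Dom A x) (Cod A j)"
    have "c \<cdot> (i2 \<cdot> x) = Zero A (Dom A (i2 \<cdot> x)) (Cod A c)" using x j C B m unfolding j_def by simp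
    then obtain y where y: "y \<in> Mor A" "Dom A y = Dom A x" "Cod A y = Dom A m" "m \<cdot> y = i2 \<cdot> x"
      using is_kernel_ex[OF mc, of "i2 \<cdot> x"] x j B C m by (metis comp_simps)
    have "i \<cdot> y = p1 \<cdot> (m \<cdot> y)" using p1m y m B by (metis assoc)
    also have "\<dots> = p1 \<cdot> i2 \<cdot> x" unfolding y(4) by (rule assoc[symmetric]) (use B x j in auto)
    finally have "i \<cdot> y = Zero A (Dom A y) (Cod A i)" by (simp add: B x j y D)
    then have "y = Zero A (Dom A y) (Cod A y)"
      using monicD[OF im, of y "Zero A (Dom A y) (Cod A y)"] Dom_Obj[OF y(1)] y(1,3) m(2) D(1,3) by simp
    then have "i2 \<cdot> x = Zero A (Dom A x) S" using y m by (metis comp_Zero Dom_Obj)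
    then have "p2 \<cdot> i2 \<cdot> x = p2 \<cdot> Zero A (Dom A x) S" using B(1-12) x j by simp
    then show "x = Zero A (Dom A x) (Cod A x)" using B x j by simp
  qed
  have "is_kernel A j q" using kernel_of_cokernel[OF _ qc] monic_normal[OF jm] by blast
  then have "short_exact A j q" using qc short_exact_iff by blast
  then show thesis using that[of u j q] u j q ui D by auto
qed

lemma Ext1_vanishes_extend:
  assumes se: "short_exact A i p" and g: "g \<in> Mor A" "Dom A g = Dom A i"
    and v: "Ext1 A (Cod A p) (Cod A g) = {Ext1_zero A (Cod A p) (Cod A g)}"
  obtains h where "h \<in> Mor A" "Dom A h = Cod A i" "Cod A h = Cod A g" "h \<cdot> i = g"
proof -
  obtain u j q where P: "u \<in> Mor A" "Dom A u = Cod A i" "Cod A u = Cod A j" "Dom A j = Cod A g" "Cod A q = Cod A p"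
    "short_exact A j q" "u \<cdot> i = j \<cdot> g" using pushout_short_exact[OF se g] by metis
  obtain r where r: "r \<in> Mor A" "Dom A r = Cod A j" "Cod A r = Dom A j" "r \<cdot> j = Id A (Dom A j)"
    using Ext1_vanishes_retraction[OF P(6)] v P by metis
  have i: "i \<in> Mor A" and j: "j \<in> Mor A" using se P(6) short_exact_iff is_kernelD by blast+
  have "r \<cdot> u \<cdot> i = r \<cdot> (j \<cdot> g)" using r P i by simp
  also have "\<dots> = r \<cdot> j \<cdot> g" by (rule assoc[symmetric]) (use r P g j in auto)
  finally have "r \<cdot> u \<cdot> i = g" using r P g by simp
  then show thesis using that[of "r \<cdot> u"] r P by simp
qed

end


context abelian_category begin

lemma Hom_into_exact_iff:
  assumes "f \<in> Mor A" "g \<in> Mor A" "Cod A f = Dom A g" "g \<cdot> f = Zero A (Dom A f) (Cod A g)" "V \<in> Obj A"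
  shows "contra_exact_at A (Hom_into A V) f g \<longleftrightarrow>
    (\<forall>h\<in>Hom A (Cod A f) V. h \<cdot> f = Zero A (Dom A f) V \<longrightarrow> (\<exists>t\<in>Hom A (Cod A g) V. t \<cdot> g = h))"
proof -
  have G: "group (hom_group A X V)" if "X \<in> Obj A" for X
    using comm_group_hom_group[OF that assms(5)] by (simp add: comm_group.axioms)
  have H: "(\<lambda>x. x \<cdot> k) \<in> hom (hom_group A (Cod A k) V) (hom_group A (Dom A k) V)" if "k \<in> Mor A" for k
    using that by (auto simp: hom_def hom_group_def Hom_iff)
  have GH: "group_hom (hom_group A (Cod A k) V) (hom_group A (Dom A k) V) (\<lambda>x. x \<cdot> k)" if "k \<in> Mor A" for k
    using that G H by (simp add: group_hom_def group_hom_axioms_def)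
  have "contra_exact_at A (Hom_into A V) f g \<longleftrightarrow>
    {h \<in> Hom A (Cod A f) V. h \<cdot> f = Zero A (Dom A f) V} = (\<lambda>x. x \<cdot> g) ` Hom A (Cod A g) V"
  proof -
    have "contra_exact_at A (Hom_into A V) f g \<longleftrightarrow>
      kernel (hom_group A (Cod A f) V) (hom_group A (Dom A f) V) (\<lambda>x. x \<cdot> f)
        = (\<lambda>x. x \<cdot> g) ` carrier (hom_group A (Cod A g) V)"
      unfolding contra_exact_at_def Hom_into_def
      by (simp add: GH[OF assms(2), folded assms(3)] G[OF Dom_Obj[OF assms(1)]] H[OF assms(1)])
    then show ?thesis by (simp add: kernel_def hom_group_def)
  qed
  also have "\<dots> \<longleftrightarrow> (\<forall>h\<in>Hom A (Cod A f) V. h \<cdot> f = Zero A (Dom A f) V \<longrightarrow> (\<exists>t\<in>Hom A (Cod A g) V. t \<cdot> g = h))"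
  proof -
    have "x \<cdot> g \<in> Hom A (Cod A f) V \<and> x \<cdot> g \<cdot> f = Zero A (Dom A f) V" if "x \<in> Hom A (Cod A g) V" for x
    proof -
      have x: "x \<in> Mor A" "Dom A x = Cod A g" "Cod A x = V" using that by (auto simp: Hom_iff)
      have "x \<cdot> g \<cdot> f = x \<cdot> (g \<cdot> f)" by (rule assoc) (use x assms in simp_all)
      then show ?thesis unfolding assms(4) using x assms(1-3) by (simp add: Hom_iff)
    qed
    then have "(\<lambda>x. x \<cdot> g) ` Hom A (Cod A g) V \<subseteq> {h \<in> Hom A (Cod A f) V. h \<cdot> f = Zero A (Dom A f) V}" by blast
    then have "{h \<in> Hom A (Cod A f) V. h \<cdot> f = Zero A (Dom A f) V} = (\<lambda>x. x \<cdot> g) ` Hom A (Cod A g) V \<longleftrightarrow>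
      {h \<in> Hom A (Cod A f) V. h \<cdot> f = Zero A (Dom A f) V} \<subseteq> (\<lambda>x. x \<cdot> g) ` Hom A (Cod A g) V"
      by (simp only: set_eq_subset) simp
    also have "\<dots> \<longleftrightarrow> (\<forall>h\<in>Hom A (Cod A f) V. h \<cdot> f = Zero A (Dom A f) V \<longrightarrow>
      h \<in> (\<lambda>x. x \<cdot> g) ` Hom A (Cod A g) V)" unfolding subset_iff mem_Collect_eq Ball_def imp_conjL ..
    finally show ?thesis by (simp only: image_iff eq_commute)
  qed
  finally show ?thesis .
qed

lemma proper_coresolution_exists_aux:
  assumes VO: "\<And>V. V \<in> \<V> \<Longrightarrow> V \<in> Obj A"
    and pre: "\<And>X. X \<in> Obj A \<Longrightarrow> \<exists>i p. short_exact A i p \<and> Dom A i = X \<and> Cod A i \<in> \<V> \<and>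
       (\<forall>V\<in>\<V>. \<forall>g\<in>Hom A X V. \<exists>h\<in>Hom A (Cod A i) V. h \<cdot> i = g)"
    and M: "M \<in> Obj A"
  shows "\<exists>\<delta>. proper_coresolution A \<V> M \<delta>"
proof -
  obtain i p where ip: "\<And>X. X \<in> Obj A \<Longrightarrow> short_exact A (i X) (p X) \<and> Dom A (i X) = X \<and> Cod A (i X) \<in> \<V> \<and>
       (\<forall>V\<in>\<V>. \<forall>g\<in>Hom A X V. \<exists>h\<in>Hom A (Cod A (i X)) V. h \<cdot> i X = g)"
    using pre by metis
  define C where "C = rec_nat M (\<lambda>_ X. Cod A (p X))"
  have C0: "C 0 = M" and CS: "\<And>n. C (Suc n) = Cod A (p (C n))" by (auto simp: C_def)
  have CO: "C n \<in> Obj A" for n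
  proof (induction n)
    case (Suc n)
    then have "is_kernel A (i (C n)) (p (C n))" using ip short_exact_iff by blast
    then show ?case using is_kernelD(2) by (simp add: CS)
  qed (simp add: C0 M)
  define \<iota> \<pi> where "\<iota> n = i (C n)" and "\<pi> n = p (C n)" for n
  have se: "short_exact A (\<iota> n) (\<pi> n)" and D\<iota>: "Dom A (\<iota> n) = C n" and C\<iota>: "Cod A (\<iota> n) \<in> \<V>"
    and C\<pi>: "Cod A (\<pi> n) = C (Suc n)" for n
    using ip[OF CO[of n]] by (simp_all add: \<iota>_def \<pi>_def CS)
  have k: "is_kernel A (\<iota> n) (\<pi> n)" "is_cokernel A (\<pi> n) (\<iota> n)" for n using se short_exact_iff by auto
  note mor = is_kernelD(1)[OF k(1)] is_kernelD(2)[OF k(1)] is_kernelD(3)[OF k(1)] is_kernelD(4)[OF k(1)]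
  have ex: "\<exists>h\<in>Hom A (Cod A (\<iota> n)) V. h \<cdot> \<iota> n = g" if "g \<in> Hom A (C n) V" "V \<in> \<V>" for g n V
    using ip[OF CO[of n]] that by (simp add: \<iota>_def)
  define \<delta> where "\<delta> = case_nat (\<iota> 0) (\<lambda>n. \<iota> (Suc n) \<cdot> \<pi> n)"
  have d0: "\<delta> 0 = \<iota> 0" and dS: "\<delta> (Suc n) = \<iota> (Suc n) \<cdot> \<pi> n" for n by (auto simp: \<delta>_def)
  have dS': "\<delta> (Suc n) \<in> Mor A" "Dom A (\<delta> (Suc n)) = Cod A (\<iota> n)" "Cod A (\<delta> (Suc n)) = Cod A (\<iota> (Suc n))" for n
    using mor D\<iota> C\<pi> by (simp_all add: dS)
  have d: "\<delta> n \<in> Mor A" "Cod A (\<delta> n) = Cod A (\<iota> n)" for n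
    using dS' mor by (cases n; simp add: d0)+
  have K: "is_kernel A (\<iota> n) (\<delta> (Suc n))" for n
  proof (rule is_kernelI)
    show "monic A (\<iota> n)" using kernel_monic k by blast
    show "\<delta> (Suc n) \<cdot> \<iota> n = Zero A (Dom A (\<iota> n)) (Cod A (\<delta> (Suc n)))"
      using mor D\<iota> C\<pi> CO by (simp add: dS)
    fix h assume h: "h \<in> Mor A" "Cod A h = Dom A (\<delta> (Suc n))" "\<delta> (Suc n) \<cdot> h = Zero A (Dom A h) (Cod A (\<delta> (Suc n)))"
    then have h2: "Cod A h = Dom A (\<pi> n)" using dS' mor by simp
    then have "\<iota> (Suc n) \<cdot> (\<pi> n \<cdot> h) = \<iota> (Suc n) \<cdot> Zero A (Dom A h) (C (Suc n))"
      using h mor D\<iota> C\<pi> CO by (simp add: dS)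
    then have "\<pi> n \<cdot> h = Zero A (Dom A h) (C (Suc n))"
      using monicD[OF kernel_monic[OF k(1)[of "Suc n"]], of "\<pi> n \<cdot> h" "Zero A (Dom A h) (C (Suc n))"] h h2 mor D\<iota> C\<pi> CO by simp
    then show "\<exists>u\<in>Hom A (Dom A h) (Dom A (\<iota> n)). \<iota> n \<cdot> u = h"
      using is_kernel_ex[OF k(1)[of n] h(1)] h2 C\<pi> by (metis Hom_iff)
  qed (use dS' mor in auto)
  have Q: "is_cokernel A (\<pi> n) (\<delta> n)" for n
  proof (cases n)
    case 0 then show ?thesis using k by (simp add: d0)
  next
    case (Suc l)
    show ?thesis unfolding Suc
    proof (rule is_cokernelI)
      show "epic A (\<pi> (Suc l))" using cokernel_epic k by blast
      have "\<pi> (Suc l) \<cdot> \<delta> (Suc l) = \<pi> (Suc l) \<cdot> \<iota> (Suc l) \<cdot> \<pi> l"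
        unfolding dS by (rule assoc[symmetric]) (use mor D\<iota> C\<pi> in auto)
      then show "\<pi> (Suc l) \<cdot> \<delta> (Suc l) = Zero A (Dom A (\<delta> (Suc l))) (Cod A (\<pi> (Suc l)))"
        using mor D\<iota> C\<pi> dS' CO by simp
      fix h assume h: "h \<in> Mor A" "Dom A h = Cod A (\<delta> (Suc l))" "h \<cdot> \<delta> (Suc l) = Zero A (Dom A (\<delta> (Suc l))) (Cod A h)"
      have h2: "Dom A h = Cod A (\<iota> (Suc l))" using h dS' by simp
      have "h \<cdot> \<iota> (Suc l) \<cdot> \<pi> l = Zero A (C (Suc l)) (Cod A h) \<cdot> \<pi> l"
        using h h2 mor D\<iota> C\<pi> CO dS' by (simp add: dS)
      then have "h \<cdot> \<iota> (Suc l) = Zero A (C (Suc l)) (Cod A h)"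
        using epicD[OF cokernel_epic[OF k(2)[of l]], of "h \<cdot> \<iota> (Suc l)" "Zero A (C (Suc l)) (Cod A h)"] h h2 mor D\<iota> C\<pi> CO by simp
      then show "\<exists>u\<in>Hom A (Cod A (\<pi> (Suc l))) (Cod A h). u \<cdot> \<pi> (Suc l) = h"
        using is_cokernel_ex[OF k(2)[of "Suc l"] h(1)] h2 D\<iota> by (metis Hom_iff)
    qed (use dS' mor in auto)
  qed
  let ?z = "Zero A (zero_object A) M"
  have ez: "exact_at A ?z (\<delta> 0)"
    using exact_from_zero_iff[OF mor(1)[of 0]] kernel_monic[OF k(1)[of 0]] by (simp add: d0 D\<iota> C0)
  have es: "exact_at A (\<delta> n) (\<delta> (Suc n))" for n unfolding exact_at_iff using Q[of n] k[of n] K[of n] by blast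
  have hz: "contra_exact_at A (Hom_into A V) ?z (\<delta> 0)" if V: "V \<in> \<V>" for V
    using ex[where n = 0 and V = V] V exact_at_Mor[OF ez] M VO d by (subst Hom_into_exact_iff) (auto simp: d0 C0)
  have hs: "contra_exact_at A (Hom_into A V) (\<delta> n) (\<delta> (Suc n))" if V: "V \<in> \<V>" for V n
  proof (subst Hom_into_exact_iff[OF exact_at_Mor[OF es] VO[OF V]], intro ballI impI)
    fix h assume h: "h \<in> Hom A (Cod A (\<delta> n)) V" "h \<cdot> \<delta> n = Zero A (Dom A (\<delta> n)) V"
    obtain t where t: "t \<in> Mor A" "Dom A t = C (Suc n)" "Cod A t = V" "t \<cdot> \<pi> n = h"
      using is_cokernel_ex[OF Q[of n], of h] h C\<pi> by (auto simp: Hom_iff)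
    then obtain s where s: "s \<in> Mor A" "Dom A s = Cod A (\<iota> (Suc n))" "Cod A s = V" "s \<cdot> \<iota> (Suc n) = t"
      using ex[of t "Suc n" V] V by (auto simp: Hom_iff)
    have "s \<cdot> \<delta> (Suc n) = s \<cdot> \<iota> (Suc n) \<cdot> \<pi> n" unfolding dS
      by (rule assoc[symmetric]) (use s mor D\<iota> C\<pi> in auto)
    then show "\<exists>t\<in>Hom A (Cod A (\<delta> (Suc n))) V. t \<cdot> \<delta> (Suc n) = h"
      using s t dS' by (auto simp: Hom_iff)
  qed
  have "proper_coresolution A \<V> M \<delta>"
    unfolding proper_coresolution_def Let_def
  proof (intro conjI allI ballI)
    show "Dom A (\<delta> 0) = M" "\<And>j. Cod A (\<delta> j) \<in> \<V>" using D\<iota> C\<iota> d by (simp_all add: d0 C0)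
    show "exact_at A (case n of 0 \<Rightarrow> ?z | Suc x \<Rightarrow> \<delta> x) (case Suc n of 0 \<Rightarrow> ?z | Suc x \<Rightarrow> \<delta> x)" for n
      using ez es by (cases n) simp_all
    show "contra_exact_at A (Hom_into A V) (case n of 0 \<Rightarrow> ?z | Suc x \<Rightarrow> \<delta> x) (case Suc n of 0 \<Rightarrow> ?z | Suc x \<Rightarrow> \<delta> x)"
      if "V \<in> \<V>" for V n
      using hz hs that by (cases n) simp_all
  qed
  then show ?thesis by blast
qed

lemma proper_coresolution_exists:
  assumes sp: "special_preenveloping A \<V>" and M: "M \<in> Obj A"
  shows "\<exists>\<delta>. proper_coresolution A \<V> M \<delta>"
proof (rule proper_coresolution_exists_aux[OF _ _ M])
  show "V \<in> Obj A" if "V \<in> \<V>" for V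
    using sp that by (auto simp: special_preenveloping_def additive_subcategory_def)
  fix X assume X: "X \<in> Obj A"
  then obtain i p where ip: "short_exact A i p" "Dom A i = X" "Cod A i \<in> \<V>" "Cod A p \<in> left_perp A \<V>"
    using sp unfolding special_preenveloping_def by blast
  have "\<exists>h\<in>Hom A (Cod A i) V. h \<cdot> i = g" if V: "V \<in> \<V>" "g \<in> Hom A X V" for V g
  proof -
    have g: "g \<in> Mor A" "Dom A g = Dom A i" "Cod A g = V" using that(2) ip(2) by (simp_all add: Hom_iff)
    moreover have "Ext1 A (Cod A p) V = {Ext1_zero A (Cod A p) V}"
      using ip(4) V(1) by (simp add: left_perp_def)
    ultimately obtain h where "h \<in> Mor A" "Dom A h = Cod A i" "Cod A h = Cod A g" "h \<cdot> i = g"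
      using Ext1_vanishes_extend[OF ip(1) g(1,2)] by metis
    then show ?thesis using g(3) by (auto simp: Hom_iff)
  qed
  then show "\<exists>i p. short_exact A i p \<and> Dom A i = X \<and> Cod A i \<in> \<V> \<and>
       (\<forall>V\<in>\<V>. \<forall>g\<in>Hom A X V. \<exists>h\<in>Hom A (Cod A i) V. h \<cdot> i = g)" using ip by blast
qed

lemma Ext1_vanishes_section:
  assumes se: "short_exact A j q" and v: "Ext1 A (Cod A q) (Dom A j) = {Ext1_zero A (Cod A q) (Dom A j)}"
  obtains s where "s \<in> Mor A" "Dom A s = Cod A q" "Cod A s = Dom A q" "q \<cdot> s = Id A (Cod A q)"
proof -
  let ?M = "Cod A q" and ?N = "Dom A j"
  have jq: "j \<in> Mor A" "q \<in> Mor A" "Cod A j = Dom A q" using se short_exact_iff is_kernelD by blast+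
  have e: "(j, q) \<in> extensions A ?M ?N" using se by (simp add: extensions_def)
  then have "ext_equiv A ?M ?N `` {(j, q)} \<in> Ext1 A ?M ?N" unfolding Ext1_def by (rule quotientI)
  then have "(j, q) \<in> Ext1_zero A ?M ?N" using v ext_equiv_refl[OF e] by auto
  then obtain i1 p2 S i2 p1 \<phi> where b: "is_biproduct A ?N ?M S i1 i2 p1 p2"
    and \<phi>: "isomorphism A \<phi>" "Dom A \<phi> = Cod A i1" "Cod A \<phi> = Cod A j" "q \<cdot> \<phi> = p2"
    by (auto simp: Ext1_zero_def ext_equiv_def)
  have B: "i1 \<in> Mor A" "Cod A i1 = S" "i2 \<in> Mor A" "Dom A i2 = ?M" "Cod A i2 = S" "p2 \<cdot> i2 = Id A ?M"
    using b by (auto simp: is_biproduct_def Hom_iff)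
  have "\<phi> \<in> Mor A" using \<phi>(1) by (simp add: isomorphism_def)
  have "q \<cdot> (\<phi> \<cdot> i2) = q \<cdot> \<phi> \<cdot> i2" by (rule assoc[symmetric]) (use B \<phi>(2,3) jq \<open>\<phi> \<in> Mor A\<close> in simp_all)
  then show thesis using that[of "\<phi> \<cdot> i2"] B \<phi>(2-4) jq \<open>\<phi> \<in> Mor A\<close> by simp
qed

end


definition op_cat :: "('o, 'm) cat \<Rightarrow> ('o, 'm) cat" where
  "op_cat A = \<lparr>Obj = Obj A, Mor = Mor A, Dom = Cod A, Cod = Dom A, Id = Id A,
     Comp = (\<lambda>g f. f \<cdot>\<^bsub>A\<^esub> g), Add = Add A, Zero = (\<lambda>X Y. Zero A Y X)\<rparr>"

lemma op_sel [simp]: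
  "Obj (op_cat A) = Obj A" "Mor (op_cat A) = Mor A" "Dom (op_cat A) = Cod A" "Cod (op_cat A) = Dom A"
  "Id (op_cat A) = Id A" "g \<cdot>\<^bsub>op_cat A\<^esub> f = f \<cdot>\<^bsub>A\<^esub> g" "Add (op_cat A) = Add A"
  "Zero (op_cat A) X Y = Zero A Y X"
  by (simp_all add: op_cat_def)

lemma op_Hom [simp]: "Hom (op_cat A) X Y = Hom A Y X"
  by (auto simp: Hom_def)

lemma op_hom_group [simp]: "hom_group (op_cat A) X Y = hom_group A Y X"
  by (simp add: hom_group_def)

lemma op_is_kernel [simp]: "is_kernel (op_cat A) k f \<longleftrightarrow> is_cokernel A k f"
  by (simp add: is_kernel_def is_cokernel_def)

lemma op_is_cokernel [simp]: "is_cokernel (op_cat A) k f \<longleftrightarrow> is_kernel A k f"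
  by (auto simp: is_kernel_def is_cokernel_def)

lemma op_monic [simp]: "monic (op_cat A) = epic A" and op_epic [simp]: "epic (op_cat A) = monic A"
  by (simp_all add: monic_def epic_def fun_eq_iff)

lemma op_is_zero_object [simp]: "is_zero_object (op_cat A) = is_zero_object A"
  by (auto simp: is_zero_object_def fun_eq_iff)

lemma op_zero_object [simp]: "zero_object (op_cat A) = zero_object A"
  by (simp add: zero_object_def)

lemma (in category) category_op: "category (op_cat A)"
  by unfold_locales (auto simp: Hom_iff)

lemma (in preadditive_category) preadditive_category_op: "preadditive_category (op_cat A)"
proof -
  interpret op: category "op_cat A" by (rule category_op)
  show ?thesis
    by (intro preadditive_category.intro preadditive_category_axioms.intro op.category_axioms)
      (auto simp: Hom_iff comm_group_hom_group)
qed

context abelian_category begin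

lemma abelian_category_op: "abelian_category (op_cat A)"
proof -
  interpret op: preadditive_category "op_cat A" by (rule preadditive_category_op)
  show ?thesis
  proof
    fix X Y assume "X \<in> Obj (op_cat A)" "Y \<in> Obj (op_cat A)"
    then obtain S i1 i2 p1 p2 where "is_biproduct A X Y S i1 i2 p1 p2" using biproduct_exists unfolding op_sel by metis
    then have "is_biproduct (op_cat A) X Y S p1 p2 i1 i2" by (simp add: is_biproduct_def)
    then show "\<exists>S i1 i2 p1 p2. is_biproduct (op_cat A) X Y S i1 i2 p1 p2" by blast
  qed (use zero_object_exists kernel_exists cokernel_exists monic_normal epic_normal in simp_all)
qed

lemma op_short_exact: "short_exact (op_cat A) i p \<longleftrightarrow> short_exact A p i"
  using abelian_category.short_exact_iff[OF abelian_category_op] short_exact_iff by auto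

lemma op_exact_at: "exact_at (op_cat A) f g \<Longrightarrow> exact_at A g f"
proof -
  assume "exact_at (op_cat A) f g"
  then obtain c m where k: "is_kernel A m f" "is_cokernel A c m" "is_cokernel A c g"
    using preadditive_category.exact_at_iff[OF preadditive_category_op] by auto
  then have "is_kernel A m c" using kernel_of_cokernel by blast
  then show ?thesis unfolding exact_at_iff using k by blast
qed

lemma op_Hom_into: "Cod A f = Dom A g \<Longrightarrow>
  contra_exact_at (op_cat A) (Hom_into (op_cat A) W) g f \<longleftrightarrow> co_exact_at A (Hom_from A W) f g"
  by (simp add: contra_exact_at_def co_exact_at_def Hom_into_def Hom_from_def)

lemma proper_resolution_exists:
  assumes sp: "special_precovering A \<W>" and N: "N \<in> Obj A"
  shows "\<exists>\<pi>. proper_resolution A \<W> N \<pi>"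
proof -
  interpret op: abelian_category "op_cat A" by (rule abelian_category_op)
  have WO: "W \<in> Obj A" if "W \<in> \<W>" for W
    using sp that by (auto simp: special_precovering_def additive_subcategory_def)
  have "\<exists>\<pi>. proper_coresolution (op_cat A) \<W> N \<pi>"
  proof (rule op.proper_coresolution_exists_aux)
    show "N \<in> Obj (op_cat A)" "\<And>W. W \<in> \<W> \<Longrightarrow> W \<in> Obj (op_cat A)" using N WO by simp_all
    fix X assume X: "X \<in> Obj (op_cat A)"
    then obtain i p where ip: "short_exact A i p" "Cod A p = X" "Dom A p \<in> \<W>" "Dom A i \<in> right_perp A \<W>"
      using sp unfolding special_precovering_def op_sel by blast
    have "\<exists>h\<in>Hom A W (Dom A p). p \<cdot> h = g" if W: "W \<in> \<W>" "g \<in> Hom A W X" for W g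
    proof -
      have g: "g \<in> Mor A" "Dom A g = W" "Cod A g = X" using W(2) by (simp_all add: Hom_iff)
      have pi: "short_exact (op_cat A) p i" using ip op_short_exact by simp
      obtain u j q where u: "u \<in> Mor A" "Cod A u = Dom A p" "Dom A u = Dom A j" "Cod A j = W" "Dom A q = Dom A i"
        "short_exact A q j" "p \<cdot> u = g \<cdot> j"
        using op.pushout_short_exact[OF pi, of g] g ip(2) unfolding op_sel op_short_exact by metis
      have "Ext1 A (Cod A j) (Dom A q) = {Ext1_zero A (Cod A j) (Dom A q)}"
        using ip(4) W(1) u(4,5) by (simp add: right_perp_def)
      then obtain s where s: "s \<in> Mor A" "Dom A s = Cod A j" "Cod A s = Dom A j" "j \<cdot> s = Id A (Cod A j)"
        using Ext1_vanishes_section[OF u(6)] by metis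
      have mor: "j \<in> Mor A" "p \<in> Mor A" using u(6) ip(1) short_exact_iff is_kernelD by blast+
      have "p \<cdot> (u \<cdot> s) = p \<cdot> u \<cdot> s" by (rule assoc[symmetric]) (use s u(1-3) mor in simp_all)
      also have "\<dots> = g \<cdot> (j \<cdot> s)" unfolding u(7) by (rule assoc) (use s u(4) g mor in simp_all)
      also have "\<dots> = g" using s(4) u(4) g by simp
      finally show ?thesis using s(1-3) u(1-4) by (intro bexI[of _ "u \<cdot> s"]) (simp_all add: Hom_iff)
    qed
    then show "\<exists>i p. short_exact (op_cat A) i p \<and> Dom (op_cat A) i = X \<and> Cod (op_cat A) i \<in> \<W> \<and>
       (\<forall>W\<in>\<W>. \<forall>g\<in>Hom (op_cat A) X W. \<exists>h\<in>Hom (op_cat A) (Cod (op_cat A) i) W. h \<cdot>\<^bsub>op_cat A\<^esub> i = g)"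
      using ip unfolding op_sel op_Hom op_short_exact by blast
  qed
  then obtain \<pi> where p: "proper_coresolution (op_cat A) \<W> N \<pi>" ..
  let ?e = "case_nat (Zero A N (zero_object A)) \<pi>"
  have ex: "exact_at (op_cat A) (?e n) (?e (Suc n))" for n
    using p unfolding proper_coresolution_def Let_def op_sel op_zero_object by blast
  have h: "co_exact_at A (Hom_from A W) (?e (Suc n)) (?e n)" if "W \<in> \<W>" for n W
  proof (subst op_Hom_into[symmetric])
    show "Cod A (?e (Suc n)) = Dom A (?e n)" using exact_at_Mor(3)[OF op_exact_at[OF ex]] .
    show "contra_exact_at (op_cat A) (Hom_into (op_cat A) W) (?e n) (?e (Suc n))"
      using p that unfolding proper_coresolution_def Let_def op_sel op_zero_object by blast
  qed
  have "proper_resolution A \<W> N \<pi>"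
    unfolding proper_resolution_def Let_def
    using p h op_exact_at[OF ex] unfolding proper_coresolution_def op_sel by blast
  then show ?thesis by blast
qed

end

end

theory Submission
  imports Defs
begin

text \<open>
  Let \<open>0 \<rightarrow> X \<rightarrow> Y \<rightarrow> Z \<rightarrow> 0\<close>, with maps \<open>i\<close> and \<open>p\<close>, be \<open>Hom(-, \<V>)\<close>-exact, and let
  \<open>d\<^sub>M : M \<rightarrow> I\<^sup>0(M)\<close> be the chosen preenvelopes, so that the stable functor is \<open>F(M) / im F(d\<^sub>M)\<close>.
  If \<open>y \<in> F(Y)\<close> satisfies \<open>F(i) y = F(d\<^sub>X) v\<close>, extend \<open>d\<^sub>X\<close> along \<open>i\<close> to \<open>e : Y \<rightarrow> I\<^sup>0(X)\<close>.
  Then \<open>y - F(e) v\<close> is killed by \<open>F(i)\<close>, so it lies in the image of \<open>F(p)\<close>, while \<open>e\<close> factors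
  through \<open>d\<^sub>Y\<close>, so that \<open>F(e) v\<close> lies in the image of \<open>F(d\<^sub>Y)\<close>. The covariant half is the
  contravariant one in the opposite category.
\<close>

section \<open>Maps induced on quotient groups\<close>

text \<open>Since \<open>h\<close> maps \<open>P\<close> into \<open>Q\<close>, every factor
  \<open>h p\<close> is absorbed by \<open>Q\<close>. The left-hand side is the shape in which
  stable functors act on morphisms, so this identifies that action with the usual induced map on
  cosets.\<close>

lemma (in group_hom) set_mult_image_rcoset:
  assumes P: "subgroup P G" and Q: "subgroup Q H" and PQ: "h ` P \<subseteq> Q" and x: "x \<in> carrier G"
  shows "Q <#>\<^bsub>H\<^esub> h ` (P #>\<^bsub>G\<^esub> x) = Q #>\<^bsub>H\<^esub> h x"
proof
  have sub: "P \<subseteq> carrier G" "Q \<subseteq> carrier H" using P Q by (simp_all add: subgroup.subset)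
  show "Q <#>\<^bsub>H\<^esub> h ` (P #>\<^bsub>G\<^esub> x) \<subseteq> Q #>\<^bsub>H\<^esub> h x"
  proof
    fix z assume "z \<in> Q <#>\<^bsub>H\<^esub> h ` (P #>\<^bsub>G\<^esub> x)"
    then obtain q p where qp: "q \<in> Q" "p \<in> P" "z = q \<otimes>\<^bsub>H\<^esub> h (p \<otimes> x)"
      by (auto simp: set_mult_def r_coset_def)
    then have "z = (q \<otimes>\<^bsub>H\<^esub> h p) \<otimes>\<^bsub>H\<^esub> h x"
      using sub x by (simp add: subset_iff H.m_assoc)
    moreover have "q \<otimes>\<^bsub>H\<^esub> h p \<in> Q" using qp PQ subgroup.m_closed[OF Q] by auto
    ultimately show "z \<in> Q #>\<^bsub>H\<^esub> h x" by (auto simp: r_coset_def)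
  qed
  have "x \<in> P #>\<^bsub>G\<^esub> x" using G.rcos_self[OF x P] .
  then show "Q #>\<^bsub>H\<^esub> h x \<subseteq> Q <#>\<^bsub>H\<^esub> h ` (P #>\<^bsub>G\<^esub> x)"
    by (auto simp: set_mult_def r_coset_def[of H])
qed

lemma hom_FactGroup_induced:
  assumes G: "comm_group G" and H: "comm_group H" and h: "h \<in> hom G H"
    and P: "subgroup P G" and Q: "subgroup Q H" and PQ: "h ` P \<subseteq> Q"
  shows "(\<lambda>X. Q <#>\<^bsub>H\<^esub> h ` X) \<in> hom (G Mod P) (H Mod Q)"
proof -
  interpret G: comm_group G by fact
  interpret H: comm_group H by fact
  interpret h: group_hom G H h using h by unfold_locales
  have nP: "P \<lhd> G" and nQ: "Q \<lhd> H" using P Q by (simp_all add: G.normal_iff_subgroup H.normal_iff_subgroup)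
  note r = h.set_mult_image_rcoset[OF P Q PQ]
  show ?thesis
    by (rule homI) (auto simp: carrier_FactGroup r normal.rcos_sum[OF nP] normal.rcos_sum[OF nQ])
qed

text \<open>The coset of \<open>y\<close> dies in \<open>D Mod R\<close> exactly when
  \<open>f y\<close> lies in \<open>R\<close>. By \<open>ex\<close>, such a \<open>y\<close> agrees
  with some \<open>g z\<close> modulo \<open>Q\<close>, which gives exactness in the middle. The
  reverse inclusion is \<open>fg\<close>.\<close>

lemma exact_seq_FactGroup:
  assumes C: "comm_group C" and B: "comm_group B" and D: "comm_group D"
    and g: "g \<in> hom C B" and f: "f \<in> hom B D"
    and PC: "subgroup P C" and QB: "subgroup Q B" and RD: "subgroup R D"
    and PQ: "g ` P \<subseteq> Q" and QR: "f ` Q \<subseteq> R"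
    and fg: "\<And>z. z \<in> carrier C \<Longrightarrow> f (g z) = \<one>\<^bsub>D\<^esub>"
    and ex: "\<And>y. \<lbrakk>y \<in> carrier B; f y \<in> R\<rbrakk> \<Longrightarrow> \<exists>q\<in>Q. \<exists>z\<in>carrier C. y = q \<otimes>\<^bsub>B\<^esub> g z"
  shows "exact_seq ([D Mod R, B Mod Q, C Mod P],
    [\<lambda>X. R <#>\<^bsub>D\<^esub> f ` X, \<lambda>X. Q <#>\<^bsub>B\<^esub> g ` X])"
proof -
  interpret C: comm_group C by fact
  interpret B: comm_group B by fact
  interpret D: comm_group D by fact
  interpret g: group_hom C B g using g by unfold_locales
  interpret f: group_hom B D f using f by unfold_locales
  have n: "P \<lhd> C" "Q \<lhd> B" "R \<lhd> D"
    using PC QB RD by (simp_all add: C.normal_iff_subgroup B.normal_iff_subgroup D.normal_iff_subgroup)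
  note rg = g.set_mult_image_rcoset[OF PC QB PQ] and rf = f.set_mult_image_rcoset[OF QB RD QR]
  \<comment> \<open>The factor \<open>q\<close> in \<open>Q\<close> disappears modulo
    \<open>Q\<close>.\<close>
  have Q1: "Q #>\<^bsub>B\<^esub> y = Q #>\<^bsub>B\<^esub> g z" if "q \<in> Q" "z \<in> carrier C" "y = q \<otimes>\<^bsub>B\<^esub> g z" for y q z
    using B.coset_mult_assoc[of Q q "g z"] that QB subgroup.subset[OF QB]
    by (auto simp: subset_iff subgroup.rcos_const[OF QB B.group_axioms])
  have "kernel (B Mod Q) (D Mod R) (\<lambda>X. R <#>\<^bsub>D\<^esub> f ` X) = (\<lambda>X. Q <#>\<^bsub>B\<^esub> g ` X) ` carrier (C Mod P)"
  proof (intro equalityI subsetI)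
    fix X assume "X \<in> kernel (B Mod Q) (D Mod R) (\<lambda>X. R <#>\<^bsub>D\<^esub> f ` X)"
    then obtain y where y: "y \<in> carrier B" "X = Q #>\<^bsub>B\<^esub> y" "R #>\<^bsub>D\<^esub> f y = R"
      by (auto simp: kernel_def carrier_FactGroup rf)
    then have "f y \<in> R" using D.rcos_self[OF _ RD, of "f y"] by simp
    then obtain q z where "q \<in> Q" "z \<in> carrier C" "y = q \<otimes>\<^bsub>B\<^esub> g z" using ex[OF y(1)] by blast
    then show "X \<in> (\<lambda>X. Q <#>\<^bsub>B\<^esub> g ` X) ` carrier (C Mod P)"
      using Q1 y by (auto simp: carrier_FactGroup rg image_image)
  next
    fix X assume "X \<in> (\<lambda>X. Q <#>\<^bsub>B\<^esub> g ` X) ` carrier (C Mod P)"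
    then obtain z where "z \<in> carrier C" "X = Q #>\<^bsub>B\<^esub> g z"
      by (auto simp: carrier_FactGroup rg)
    then show "X \<in> kernel (B Mod Q) (D Mod R) (\<lambda>X. R <#>\<^bsub>D\<^esub> f ` X)"
      using fg D.coset_mult_one[OF subgroup.subset[OF RD]] by (auto simp: kernel_def carrier_FactGroup rf)
  qed
  then show ?thesis
    using hom_FactGroup_induced[OF C B g PC QB PQ] hom_FactGroup_induced[OF B D f QB RD QR]
      n[THEN normal.factorgroup_is_group]
    by (simp add: group_hom_def group_hom_axioms_def)
qed

section \<open>Stable functors\<close>

context
  fixes A :: "('o, 'm) cat" and F :: "('o, 'm, 'g) functor_to_Ab"
  assumes A: "abelian_category A" and F: "contravariant_additive_functor A F"
begin

interpretation abelian_category A by (rule A)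

lemma FObj_comm_group: "X \<in> Obj A \<Longrightarrow> comm_group (FObj F X)"
  and FMor_hom: "f \<in> Hom A X Y \<Longrightarrow> FMor F f \<in> hom (FObj F Y) (FObj F X)"
  and FMor_comp: "\<lbrakk>f \<in> Hom A X Y; g \<in> Hom A Y Z; x \<in> carrier (FObj F Z)\<rbrakk>
    \<Longrightarrow> FMor F (g \<cdot>\<^bsub>A\<^esub> f) x = FMor F f (FMor F g x)"
  and FMor_add: "\<lbrakk>f \<in> Hom A X Y; g \<in> Hom A X Y; x \<in> carrier (FObj F Y)\<rbrakk>
    \<Longrightarrow> FMor F (f \<boxplus>\<^bsub>A\<^esub> g) x = FMor F f x \<otimes>\<^bsub>FObj F X\<^esub> FMor F g x"
  using F unfolding contravariant_additive_functor_def by blast+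

lemma FMor_closed: "\<lbrakk>f \<in> Hom A X Y; x \<in> carrier (FObj F Y)\<rbrakk> \<Longrightarrow> FMor F f x \<in> carrier (FObj F X)"
  using FMor_hom by (meson hom_in_carrier)

lemma FMor_group_hom:
  assumes "f \<in> Hom A X Y" shows "group_hom (FObj F Y) (FObj F X) (FMor F f)"
  using FMor_hom[OF assms] FObj_comm_group assms
  by (auto simp: Hom_iff group_hom_def group_hom_axioms_def comm_group.axioms(2))

text \<open>Additivity applied to \<open>0 + 0 = 0\<close> makes the value idempotent, hence trivial
  in a group.\<close>

lemma FMor_Zero:
  assumes X: "X \<in> Obj A" and Y: "Y \<in> Obj A" and x: "x \<in> carrier (FObj F Y)"
  shows "FMor F (Zero A X Y) x = \<one>\<^bsub>FObj F X\<^esub>"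
proof -
  interpret X: comm_group "FObj F X" using X by (rule FObj_comm_group)
  have z: "Zero A X Y \<in> Hom A X Y" using X Y by (simp add: Hom_iff)
  then have c: "FMor F (Zero A X Y) x \<in> carrier (FObj F X)" using FMor_closed x by blast
  have "FMor F (Zero A X Y) x \<otimes>\<^bsub>FObj F X\<^esub> FMor F (Zero A X Y) x = FMor F (Zero A X Y) x"
    using FMor_add[OF z z x] X Y by simp
  then show ?thesis using c by simp
qed

lemma image_FMor_subgroup:
  assumes "f \<in> Hom A X Y" shows "subgroup (FMor F f ` carrier (FObj F Y)) (FObj F X)"
  using group_hom.img_is_subgroup[OF FMor_group_hom[OF assms]] .

text \<open>As the composite of \<open>\<delta> 0\<close> and \<open>\<delta> 1\<close> is zero,
  \<open>F (\<delta> 0)\<close> factors through the cokernel of \<open>F (\<delta> 1)\<close>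
  without changing its image. This identifies the stable functor with F(M) modulo the image of F of
  the augmentation.\<close>

lemma rho_image:
  assumes e: "exact_at A (\<delta> 0) (\<delta> 1)"
  shows "rho F \<delta> ` carrier (L0_contra A F \<delta>) = FMor F (\<delta> 0) ` carrier (FObj F (Cod A (\<delta> 0)))"
proof -
  note D = exact_at_Mor[OF e]
  let ?K = "FObj F (Cod A (\<delta> 0))" let ?N = "FMor F (\<delta> 1) ` carrier (FObj F (Cod A (\<delta> 1)))"
  have d0: "\<delta> 0 \<in> Hom A (Dom A (\<delta> 0)) (Cod A (\<delta> 0))" and d1: "\<delta> 1 \<in> Hom A (Cod A (\<delta> 0)) (Cod A (\<delta> 1))"
    using D by (simp_all add: Hom_iff)
  interpret h: group_hom ?K "FObj F (Dom A (\<delta> 0))" "FMor F (\<delta> 0)" using FMor_group_hom[OF d0] .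
  have N: "subgroup ?N ?K" using image_FMor_subgroup[OF d1] .
  have "FMor F (\<delta> 0) y = \<one>\<^bsub>FObj F (Dom A (\<delta> 0))\<^esub>" if "y \<in> ?N" for y
    using that FMor_comp[OF d0 d1] D FMor_Zero by auto
  \<comment> \<open>A coset is sent to a single point, so \<open>the_elem\<close> in
    \<open>rho\<close> is determined.\<close>
  then have "FMor F (\<delta> 0) ` (?N #>\<^bsub>?K\<^esub> x) = {FMor F (\<delta> 0) x}" if x: "x \<in> carrier ?K" for x
    using x subgroup.subset[OF N] h.G.rcos_self[OF x N] by (fastforce simp: r_coset_def)
  then have "rho F \<delta> (?N #>\<^bsub>?K\<^esub> x) = FMor F (\<delta> 0) x" if "x \<in> carrier ?K" for x
    using that by (simp add: rho_def)
  then show ?thesis by (simp add: L0_contra_def group_coker_def carrier_FactGroup image_image)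
qed

lemma stable_contra_half_exact:
  assumes V: "\<And>V. V \<in> \<V> \<Longrightarrow> V \<in> Obj A"
    and half: "half_Hom_into_exact A \<V> F" and I: "proper_coresolutions A \<V> I"
  shows "half_Hom_into_exact A \<V> (stable_contra A F I)"
  unfolding half_Hom_into_exact_def
proof (intro allI impI, elim conjE)
  fix i p assume se: "short_exact A i p"
    and hV: "\<forall>V\<in>\<V>. successively (contra_exact_at A (Hom_into A V)) (ses A i p)"
  define d where "d M = I M 0" for M
  define Q where "Q M = FMor F (d M) ` carrier (FObj F (Cod A (d M)))" for M
  \<comment> \<open>The list is shifted by one: index 0 expresses exactness at \<open>M\<close>,
    index 1 exactness at the first term of the coresolution.\<close>
  have PI: "Dom A (I M 0) = M" "\<And>j. Cod A (I M j) \<in> \<V>"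
    "\<And>n. exact_at A (case_nat (Zero A (zero_object A) M) (I M) n) (I M n)"
    "\<And>V n. V \<in> \<V> \<Longrightarrow> contra_exact_at A (Hom_into A V) (case_nat (Zero A (zero_object A) M) (I M) n) (I M n)"
    if "M \<in> Obj A" for M
    using I that unfolding proper_coresolutions_def proper_coresolution_def Let_def by auto
  have d: "d M \<in> Hom A M (Cod A (d M))" "Cod A (d M) \<in> \<V>" if "M \<in> Obj A" for M
    using PI(1,2)[OF that] exact_at_Mor(2)[OF PI(3)[OF that, of 0]] by (simp_all add: d_def Hom_iff)
  \<comment> \<open>A composite with a map out of the zero object vanishes, so Hom-exactness at the
    source of \<open>m\<close> says that every map into \<open>V\<close> extends along
    \<open>m\<close>. It is applied to the augmentations and to \<open>i\<close>.\<close>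
  have from_zero: "\<exists>t\<in>Hom A (Cod A m) V. t \<cdot>\<^bsub>A\<^esub> m = h"
    if e: "contra_exact_at A (Hom_into A V) (Zero A (zero_object A) (Dom A m)) m"
      and m: "m \<in> Mor A" and "V \<in> \<V>" and h: "h \<in> Hom A (Dom A m) V" for V m h
  proof -
    have "h \<cdot>\<^bsub>A\<^esub> Zero A (zero_object A) (Dom A m) = Zero A (zero_object A) V"
      using h m by (auto simp: Hom_iff)
    then show ?thesis
      using e h m V[OF \<open>V \<in> \<V>\<close>]
      by (subst (asm) Hom_into_exact_iff) (auto simp: Hom_iff)
  qed
  have ext_d: "\<exists>t\<in>Hom A (Cod A (d M)) V. t \<cdot>\<^bsub>A\<^esub> d M = h" if "M \<in> Obj A" "V \<in> \<V>" "h \<in> Hom A M V" for M V h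
    using from_zero[of V "d M" h] PI(4)[OF that(1,2), of 0] d[OF that(1)] that by (simp add: d_def Hom_iff)
  have ip: "is_kernel A i p" using se short_exact_iff by blast
  define X Y Z where "X = Dom A i" and "Y = Cod A i" and "Z = Cod A p"
  have i: "i \<in> Hom A X Y" and p: "p \<in> Hom A Y Z" and XYZ: "X \<in> Obj A" "Y \<in> Obj A" "Z \<in> Obj A"
    using is_kernelD[OF ip] by (auto simp: X_def Y_def Z_def Hom_iff)
  have pi: "p \<cdot>\<^bsub>A\<^esub> i = Zero A X Z" using is_kernelD[OF ip] by (simp add: X_def Z_def)
  have F_ex: "contra_exact_at A F i p" using half se hV unfolding half_Hom_into_exact_def by blast
  then have ker: "kernel (FObj F Y) (FObj F X) (FMor F i) = FMor F p ` carrier (FObj F Z)"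
    by (simp add: contra_exact_at_def X_def Y_def Z_def)
  have Qs: "subgroup (Q M) (FObj F M)" if "M \<in> Obj A" for M
    unfolding Q_def using image_FMor_subgroup[OF d(1)[OF that]] .
  \<comment> \<open>Extending \<open>d N\<close> after \<open>f\<close> along \<open>d M\<close>
    gives a comparison map \<open>e\<close>, and applying F to the resulting square moves
    \<open>Q N\<close> into \<open>Q M\<close>.\<close>
  have nat: "FMor F f ` Q N \<subseteq> Q M" if f: "f \<in> Hom A M N" for f M N
  proof
    have MN: "M \<in> Obj A" "N \<in> Obj A" using f by (auto simp: Hom_iff)
    fix y assume "y \<in> FMor F f ` Q N"
    then obtain v where v: "v \<in> carrier (FObj F (Cod A (d N)))" "y = FMor F f (FMor F (d N) v)"
      by (auto simp: Q_def)
    obtain e where e: "e \<in> Hom A (Cod A (d M)) (Cod A (d N))" "e \<cdot>\<^bsub>A\<^esub> d M = d N \<cdot>\<^bsub>A\<^esub> f"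
      using ext_d[OF MN(1) d(2)[OF MN(2)], of "d N \<cdot>\<^bsub>A\<^esub> f"] comp_Hom[OF f d(1)[OF MN(2)]] by blast
    have "y = FMor F (d M) (FMor F e v)"
      using v(2) FMor_comp[OF f d(1)[OF MN(2)] v(1)] FMor_comp[OF d(1)[OF MN(1)] e(1) v(1)] e(2) by simp
    then show "y \<in> Q M" using FMor_closed[OF e(1) v(1)] by (auto simp: Q_def)
  qed
  have ses_ex: "\<exists>q\<in>Q Y. \<exists>z\<in>carrier (FObj F Z). y = q \<otimes>\<^bsub>FObj F Y\<^esub> FMor F p z"
    if y: "y \<in> carrier (FObj F Y)" "FMor F i y \<in> Q X" for y
  proof -
    interpret Y: comm_group "FObj F Y" using XYZ(2) by (rule FObj_comm_group)
    interpret fi: group_hom "FObj F Y" "FObj F X" "FMor F i" using FMor_group_hom[OF i] .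
    obtain v where v: "v \<in> carrier (FObj F (Cod A (d X)))" "FMor F i y = FMor F (d X) v"
      using y(2) by (auto simp: Q_def)
    have dX: "d X \<in> Hom A X (Cod A (d X))" "Cod A (d X) \<in> \<V>" using d[OF XYZ(1)] .
    \<comment> \<open>The Hom-exactness of the given sequence is used for the first term of the
      coresolution of \<open>X\<close>, making \<open>d X\<close> extend along
      \<open>i\<close>.\<close>
    have "contra_exact_at A (Hom_into A (Cod A (d X))) (Zero A (zero_object A) X) i"
      using hV dX(2) by (auto simp: ses_def X_def)
    then obtain e where e: "e \<in> Hom A Y (Cod A (d X))" "e \<cdot>\<^bsub>A\<^esub> i = d X"
      using from_zero[of "Cod A (d X)" i "d X"] dX i by (auto simp: Hom_iff)
    obtain e' where e': "e' \<in> Hom A (Cod A (d Y)) (Cod A (d X))" "e' \<cdot>\<^bsub>A\<^esub> d Y = e"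
      using ext_d[OF XYZ(2) dX(2) e(1)] by blast
    define q where "q = FMor F e v"
    have q: "q \<in> carrier (FObj F Y)" unfolding q_def using FMor_closed[OF e(1) v(1)] .
    have "q = FMor F (d Y) (FMor F e' v)"
      unfolding q_def using FMor_comp[OF d(1)[OF XYZ(2)] e'(1) v(1)] e'(2) by simp
    then have qQ: "q \<in> Q Y" using FMor_closed[OF e'(1) v(1)] by (auto simp: Q_def)
    have "FMor F i q = FMor F i y"
      unfolding q_def v(2) using FMor_comp[OF i e(1) v(1)] e(2) by simp
    \<comment> \<open>In additive notation this is \<open>y - F(e) v\<close>; it is killed by
      \<open>F(i)\<close> because \<open>e\<close> restricts to \<open>d X\<close> along
      \<open>i\<close>.\<close>
    then have "inv\<^bsub>FObj F Y\<^esub> q \<otimes>\<^bsub>FObj F Y\<^esub> y \<in> kernel (FObj F Y) (FObj F X) (FMor F i)"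
      using q y(1) by (simp add: kernel_def)
    then obtain z where z: "z \<in> carrier (FObj F Z)" "inv\<^bsub>FObj F Y\<^esub> q \<otimes>\<^bsub>FObj F Y\<^esub> y = FMor F p z"
      unfolding ker by blast
    have "y = q \<otimes>\<^bsub>FObj F Y\<^esub> FMor F p z"
      using q y(1) by (simp flip: z(2) Y.m_assoc)
    then show ?thesis using qQ z(1) by blast
  qed
  have "exact_seq ([FObj F X Mod Q X, FObj F Y Mod Q Y, FObj F Z Mod Q Z],
    [\<lambda>S. Q X <#>\<^bsub>FObj F X\<^esub> FMor F i ` S, \<lambda>S. Q Y <#>\<^bsub>FObj F Y\<^esub> FMor F p ` S])"
  proof (rule exact_seq_FactGroup)
    show "FMor F i (FMor F p z) = \<one>\<^bsub>FObj F X\<^esub>" if "z \<in> carrier (FObj F Z)" for z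
      using FMor_comp[OF i p that] FMor_Zero[OF XYZ(1,3) that] by (simp add: pi)
  qed (use XYZ FObj_comm_group FMor_hom i p Qs nat ses_ex in auto)
  moreover have "rho F (I M) ` carrier (L0_contra A F (I M)) = Q M" if "M \<in> Obj A" for M
    using rho_image[of "I M"] PI(3)[OF that, of 1] by (simp add: Q_def d_def)
  moreover have "Dom A i = X" "Cod A i = Y" "Dom A p = Y" "Cod A p = Z" using i p by (simp_all add: Hom_iff)
  ultimately show "contra_exact_at A (stable_contra A F I) i p"
    using XYZ by (simp add: contra_exact_at_def stable_contra_def group_coker_def)
qed

end

section \<open>Duality\<close>

lemma op_op_cat [simp]: "op_cat (op_cat A) = A"
  by (simp add: op_cat_def)

text \<open>Passing to the opposite swaps only \<open>Dom\<close> and \<open>Cod\<close>; the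
  premise makes the two descriptions of the middle group agree.\<close>

lemma contra_exact_at_op:
  "Cod A f = Dom A g \<Longrightarrow> contra_exact_at (op_cat A) G g f \<longleftrightarrow> co_exact_at A G f g"
  by (simp add: contra_exact_at_def co_exact_at_def)

lemma Hom_into_op: "Hom_into (op_cat A) W = Hom_from A W"
  by (simp add: Hom_into_def Hom_from_def)

lemma covariant_additive_functor_op:
  "covariant_additive_functor A G \<Longrightarrow> contravariant_additive_functor (op_cat A) G"
  unfolding covariant_additive_functor_def contravariant_additive_functor_def by simp

text \<open>\<open>rho\<close> does not depend on the variance, so both records unfold to the same
  terms once \<open>Dom\<close> and \<open>Cod\<close> are swapped.\<close>

lemma stable_contra_op: "stable_contra (op_cat A) G P = stable_co A G P"
  by (simp add: stable_contra_def stable_co_def L0_contra_def L0_co_def)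

context abelian_category begin

lemma exact_at_op: "exact_at A f g \<Longrightarrow> exact_at (op_cat A) g f"
  using abelian_category.op_exact_at[OF abelian_category_op] by simp

text \<open>\<open>ses (op_cat A) p i\<close> is \<open>ses A i p\<close> read backwards, the two
  outer zero maps changing places, so the exactness conditions match one by one.\<close>

lemma successively_Hom_into_op:
  assumes "short_exact A i p"
  shows "successively (contra_exact_at (op_cat A) (Hom_into (op_cat A) W)) (ses (op_cat A) p i) \<longleftrightarrow>
    successively (co_exact_at A (Hom_from A W)) (ses A i p)"
proof -
  have k: "is_kernel A i p" using assms short_exact_iff by blast
  note D = is_kernelD[OF k]
  show ?thesis using D by (auto simp: ses_def Hom_into_op contra_exact_at_op)
qed

lemma half_Hom_into_exact_op:
  "half_Hom_into_exact (op_cat A) \<W> G \<longleftrightarrow> half_Hom_from_exact A \<W> G"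
proof -
  have "contra_exact_at (op_cat A) G p i \<longleftrightarrow> co_exact_at A G i p" if "short_exact A i p" for i p
    using that is_kernelD(3) contra_exact_at_op short_exact_iff by metis
  then show ?thesis
    unfolding half_Hom_into_exact_def half_Hom_from_exact_def op_short_exact
    using successively_Hom_into_op by blast
qed

text \<open>The same family \<open>\<pi>\<close> serves: the map from \<open>N\<close> to zero
  becomes the map from zero to \<open>N\<close> in the opposite category, and each exactness
  condition is dualised separately.\<close>

lemma proper_coresolution_op:
  assumes "proper_resolution A \<W> N \<pi>"
  shows "proper_coresolution (op_cat A) \<W> N \<pi>"
proof -
  let ?e = "case_nat (Zero A N (zero_object A)) \<pi>"
  have P: "Cod A (\<pi> 0) = N" "\<And>j. Dom A (\<pi> j) \<in> \<W>" "\<And>n. exact_at A (?e (Suc n)) (?e n)"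
    "\<And>W n. W \<in> \<W> \<Longrightarrow> co_exact_at A (Hom_from A W) (?e (Suc n)) (?e n)"
    using assms unfolding proper_resolution_def Let_def by blast+
  have "contra_exact_at (op_cat A) (Hom_into (op_cat A) W) (?e n) (?e (Suc n))" if "W \<in> \<W>" for W n
    unfolding Hom_into_op using P(4)[OF that] contra_exact_at_op[OF exact_at_Mor(3)[OF P(3)]] by blast
  then show ?thesis
    unfolding proper_coresolution_def Let_def op_sel op_zero_object using P(1,2) exact_at_op[OF P(3)] by blast
qed

lemma stable_co_half_exact:
  assumes G: "covariant_additive_functor A G" and W: "\<And>W. W \<in> \<W> \<Longrightarrow> W \<in> Obj A"
    and half: "half_Hom_from_exact A \<W> G" and P: "proper_resolutions A \<W> P"
  shows "half_Hom_from_exact A \<W> (stable_co A G P)"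
proof -
  have "proper_coresolutions (op_cat A) \<W> P"
    using P proper_coresolution_op by (simp add: proper_coresolutions_def proper_resolutions_def)
  then show ?thesis
    using stable_contra_half_exact[OF abelian_category_op covariant_additive_functor_op[OF G], of \<W> P] W half
    by (simp add: half_Hom_into_exact_op stable_contra_op)
qed

end

theorem lemma2p14:
  fixes A :: "('o, 'm) cat" and \<V> \<W> :: "'o set"
    and F :: "('o, 'm, 'g) functor_to_Ab" and G :: "('o, 'm, 'h) functor_to_Ab"
  assumes "abelian_category A"
    and "special_preenveloping A \<V>" and "special_precovering A \<W>"
    and "contravariant_additive_functor A F" and "covariant_additive_functor A G"
  shows "(half_Hom_into_exact A \<V> F \<longrightarrow>
      (\<forall>I. proper_coresolutions A \<V> I \<longrightarrow> half_Hom_into_exact A \<V> (stable_contra A F I))) \<and>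
    (half_Hom_from_exact A \<W> G \<longrightarrow>
      (\<forall>P. proper_resolutions A \<W> P \<longrightarrow> half_Hom_from_exact A \<W> (stable_co A G P)))"
proof -
  have "\<V> \<subseteq> Obj A" "\<W> \<subseteq> Obj A"
    using assms(2,3)
    by (simp_all add: special_preenveloping_def special_precovering_def additive_subcategory_def)
  then show ?thesis
    using stable_contra_half_exact[OF assms(1,4)] abelian_category.stable_co_half_exact[OF assms(1,5)]
    by blast
qed

end
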